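(* Let $M=f^{-1}(\cos4\theta)\subset S^{2l-1}$ be an isoparametric hypersurface of OT--FKM type with induced metric $g$ and principal distributions $\mathcal{D}_1,\dots,\mathcal{D}_4$. Suppose that $M$ admits an almost Hermitian structure $J$ with respect to the induced metric $g$ which maps $\mathcal{D}_1$ to $\mathcal{D}_3$ and $\mathcal{D}_2$ to $\mathcal{D}_4$. Then the $*$-Ricci curvature of $(M,J,g)$ vanishes identically.
   Context: A symmetric Clifford system on $\mathbb{R}^{2l}$ is an $(m+1)$-tuple $\{P_0,\dots,P_m\}$ ($m\ge 1$) of symmetric orthogonal $2l\times 2l$ real matrices satisfying $P_iP_j+P_jP_i=2\delta_{ij}I$. Put $F(x)=|x|^4-2\sum_{i=0}^m\langle P_ix,x\rangle^2$ on $\mathbb{R}^{2l}$ and $f=F|_{S^{2l-1}}$, where $S^{2l-1}$ is the unit sphere. An isoparametric hypersurface of OT--FKM type is a level set $M=f^{-1}(\cos 4\theta)$ for a constant $\theta\in(0,\pi/4)$. It is assumed that $m_1:=m$ and $m_2:=l-m-1$ are both positive. With respect to the unit normal $\xi=\nabla^S f/|\nabla^S f|$ ($\nabla^S$ the gradient on the sphere) and the shape operator $A_\xi$ given by $d\xi=-A_\xi$ on $TM$, $M$ has four distinct constant principal curvatures $\lambda_k=\cot(\theta+\frac{k-1}{4}\pi)$, $k=1,2,3,4$, with multiplicities $(m_1,m_2,m_1,m_2)$. The principal distribution $\mathcal{D}_k\subset TM$ is the eigenbundle of $A_\xi$ for the eigenvalue $\lambda_k$. An almost Hermitian structure with respect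 to $g$ is an endomorphism $J:TM\to TM$ with $J^2=-\mathrm{Id}$ and $g(JX,JY)=g(X,Y)$. The $*$-Ricci curvature of an almost Hermitian manifold $(M,J,g)$ is $$*\mathrm{Ric}(X,Y)=\operatorname{Tr}\bigl(Z\mapsto -\tfrac12 J\circ R(X,JY)Z\bigr),$$ where $R$ is the Riemann curvature tensor of $g$, with sign convention such that the unit sphere has $\langle R(X,Y)Z,W\rangle=\langle X,Z\rangle\langle Y,W\rangle-\langle X,W\rangle\langle Y,Z\rangle$. *)

theory Defs
  imports "HOL-Analysis.Analysis"
begin

section \<open>Smooth maps and vector fields on subsets of a Euclidean space\<close>

text \<open>
  Submanifolds are treated as subsets \<open>M\<close> of a Euclidean space, carrying the metric induced by the
  ambient inner product. Maps and vector fields on \<open>M\<close> are functions on the ambient space of which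
  only the values on \<open>M\<close> matter.
\<close>

fun Ck_on :: "nat \<Rightarrow> 'a::euclidean_space set \<Rightarrow> ('a \<Rightarrow> 'b::real_normed_vector) \<Rightarrow> bool" where
  "Ck_on 0 U f \<longleftrightarrow> continuous_on U f"
| "Ck_on (Suc n) U f \<longleftrightarrow>
     (\<forall>x\<in>U. f differentiable (at x)) \<and> (\<forall>v. Ck_on n U (\<lambda>x. frechet_derivative f (at x) v))"

text \<open>For open \<open>U\<close> the following is smoothness in the usual sense.\<close>

definition smooth_on :: "'a::euclidean_space set \<Rightarrow> ('a \<Rightarrow> 'b::real_normed_vector) \<Rightarrow> bool" where
  "smooth_on U f \<longleftrightarrow> (\<forall>n. Ck_on n U f)"

definition smooth_map :: "'a::euclidean_space set \<Rightarrow> ('a \<Rightarrow> 'b::real_normed_vector) \<Rightarrow> bool" where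
  "smooth_map M f \<longleftrightarrow>
     (\<forall>p\<in>M. \<exists>U h. open U \<and> p \<in> U \<and> smooth_on U h \<and> (\<forall>q\<in>M \<inter> U. f q = h q))"

text \<open>Velocities at \<open>p\<close> of curves in \<open>M\<close>. For an embedded submanifold it makes no difference how
  regular the curves are away from parameter 0.\<close>

definition tangent_space :: "'a::euclidean_space set \<Rightarrow> 'a \<Rightarrow> 'a set" where
  "tangent_space M p =
     {v. \<exists>\<gamma> e. e > 0 \<and> (\<forall>t. \<bar>t\<bar> < e \<longrightarrow> \<gamma> t \<in> M) \<and> \<gamma> 0 = p \<and>
           (\<gamma> has_vector_derivative v) (at (0::real))}"

text \<open>The differential at \<open>p\<close> of a map \<open>f\<close> on \<open>M\<close>. It is applied only to vectors \<open>v\<close> tangent to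
  \<open>M\<close>; there, by the chain rule, the derivative within \<open>M\<close> is uniquely determined.\<close>

definition differential ::
  "'a::euclidean_space set \<Rightarrow> ('a \<Rightarrow> 'b::real_normed_vector) \<Rightarrow> 'a \<Rightarrow> 'a \<Rightarrow> 'b" where
  "differential M f p v = frechet_derivative f (at p within M) v"

definition gradient_on :: "'a::euclidean_space set \<Rightarrow> ('a \<Rightarrow> real) \<Rightarrow> 'a \<Rightarrow> 'a" where
  "gradient_on M f p =
     (THE w. w \<in> tangent_space M p \<and> (\<forall>v\<in>tangent_space M p. differential M f p v = w \<bullet> v))"

definition vector_fields :: "'a::euclidean_space set \<Rightarrow> ('a \<Rightarrow> 'a) set" where
  "vector_fields M = {X. smooth_map M X \<and> (\<forall>p\<in>M. X p \<in> tangent_space M p)}"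

text \<open>The bracket \<open>[X,Y]\<close>, with \<open>[X,Y] f = X (Y f) - Y (X f)\<close> evaluated on the ambient coordinate
  functions \<open>f\<close>.\<close>

definition lie_bracket ::
  "'a::euclidean_space set \<Rightarrow> ('a \<Rightarrow> 'a) \<Rightarrow> ('a \<Rightarrow> 'a) \<Rightarrow> 'a \<Rightarrow> 'a" where
  "lie_bracket M X Y p = differential M Y p (X p) - differential M X p (Y p)"


section \<open>Levi-Civita connection and curvature of the induced metric\<close>

text \<open>The first clause says that a connection only sees the restrictions of its arguments to \<open>M\<close>.\<close>

definition affine_connection ::
  "'a::euclidean_space set \<Rightarrow> (('a \<Rightarrow> 'a) \<Rightarrow> ('a \<Rightarrow> 'a) \<Rightarrow> 'a \<Rightarrow> 'a) \<Rightarrow> bool" where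
  "affine_connection M nabla \<longleftrightarrow>
     (\<forall>X\<in>vector_fields M. \<forall>X'\<in>vector_fields M. \<forall>Y\<in>vector_fields M. \<forall>Y'\<in>vector_fields M.
        (\<forall>q\<in>M. X q = X' q \<and> Y q = Y' q) \<longrightarrow> (\<forall>p\<in>M. nabla X Y p = nabla X' Y' p)) \<and>
     (\<forall>X\<in>vector_fields M. \<forall>Y\<in>vector_fields M. nabla X Y \<in> vector_fields M) \<and>
     (\<forall>X\<in>vector_fields M. \<forall>X'\<in>vector_fields M. \<forall>Y\<in>vector_fields M. \<forall>p\<in>M.
        nabla (\<lambda>q. X q + X' q) Y p = nabla X Y p + nabla X' Y p) \<and>
     (\<forall>X\<in>vector_fields M. \<forall>Y\<in>vector_fields M. \<forall>Y'\<in>vector_fields M. \<forall>p\<in>M.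
        nabla X (\<lambda>q. Y q + Y' q) p = nabla X Y p + nabla X Y' p) \<and>
     (\<forall>h. smooth_map M h \<longrightarrow> (\<forall>X\<in>vector_fields M. \<forall>Y\<in>vector_fields M. \<forall>p\<in>M.
        nabla (\<lambda>q. h q *\<^sub>R X q) Y p = h p *\<^sub>R nabla X Y p \<and>
        nabla X (\<lambda>q. h q *\<^sub>R Y q) p = differential M h p (X p) *\<^sub>R Y p + h p *\<^sub>R nabla X Y p))"

definition is_levi_civita ::
  "'a::euclidean_space set \<Rightarrow> (('a \<Rightarrow> 'a) \<Rightarrow> ('a \<Rightarrow> 'a) \<Rightarrow> 'a \<Rightarrow> 'a) \<Rightarrow> bool" where
  "is_levi_civita M nabla \<longleftrightarrow>
     affine_connection M nabla \<and>
     (\<forall>X\<in>vector_fields M. \<forall>Y\<in>vector_fields M. \<forall>p\<in>M.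
        nabla X Y p - nabla Y X p = lie_bracket M X Y p) \<and>
     (\<forall>X\<in>vector_fields M. \<forall>Y\<in>vector_fields M. \<forall>Z\<in>vector_fields M. \<forall>p\<in>M.
        differential M (\<lambda>q. Y q \<bullet> Z q) p (X p) = nabla X Y p \<bullet> Z p + Y p \<bullet> nabla X Z p)"

text \<open>Unique as far as fields on \<open>M\<close> are concerned; the choice only affects irrelevant values.\<close>

definition levi_civita ::
  "'a::euclidean_space set \<Rightarrow> ('a \<Rightarrow> 'a) \<Rightarrow> ('a \<Rightarrow> 'a) \<Rightarrow> 'a \<Rightarrow> 'a" where
  "levi_civita M = (SOME nabla. is_levi_civita M nabla)"

text \<open>The sign is the one for which the unit sphere has
  \<open>\<langle>R(X,Y)Z,W\<rangle> = \<langle>X,Z\<rangle>\<langle>Y,W\<rangle> - \<langle>X,W\<rangle>\<langle>Y,Z\<rangle>\<close>.\<close>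

definition curvature_field ::
  "'a::euclidean_space set \<Rightarrow> ('a \<Rightarrow> 'a) \<Rightarrow> ('a \<Rightarrow> 'a) \<Rightarrow> ('a \<Rightarrow> 'a) \<Rightarrow> 'a \<Rightarrow> 'a" where
  "curvature_field M X Y Z p =
     levi_civita M (lie_bracket M X Y) Z p
     - (levi_civita M X (levi_civita M Y Z) p - levi_civita M Y (levi_civita M X Z) p)"

text \<open>The tensor at \<open>p\<close>: the common value for all fields extending the tangent vectors
  \<open>u\<close>, \<open>v\<close>, \<open>w\<close>.\<close>

definition riemann :: "'a::euclidean_space set \<Rightarrow> 'a \<Rightarrow> 'a \<Rightarrow> 'a \<Rightarrow> 'a \<Rightarrow> 'a" where
  "riemann M p u v w =
     (THE r. \<forall>X\<in>vector_fields M. \<forall>Y\<in>vector_fields M. \<forall>Z\<in>vector_fields M.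
        X p = u \<and> Y p = v \<and> Z p = w \<longrightarrow> curvature_field M X Y Z p = r)"


section \<open>Almost Hermitian structures and the *-Ricci curvature\<close>

definition almost_hermitian :: "'a::euclidean_space set \<Rightarrow> ('a \<Rightarrow> 'a \<Rightarrow> 'a) \<Rightarrow> bool" where
  "almost_hermitian M J \<longleftrightarrow>
     (\<forall>p\<in>M. \<forall>u\<in>tangent_space M p. \<forall>v\<in>tangent_space M p.
        J p u \<in> tangent_space M p \<and>
        (\<forall>a b. J p (a *\<^sub>R u + b *\<^sub>R v) = a *\<^sub>R J p u + b *\<^sub>R J p v) \<and>
        J p (J p u) = - u \<and>
        J p u \<bullet> J p v = u \<bullet> v) \<and>
     (\<forall>X\<in>vector_fields M. (\<lambda>p. J p (X p)) \<in> vector_fields M)"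

text \<open>Trace of an endomorphism of the subspace \<open>V\<close>, as the sum of the diagonal entries with respect
  to some basis; its values off \<open>V\<close> are irrelevant.\<close>

definition trace_on :: "'a::euclidean_space set \<Rightarrow> ('a \<Rightarrow> 'a) \<Rightarrow> real" where
  "trace_on V T =
     (let B = (SOME B. independent B \<and> span B = V) in \<Sum>b\<in>B. representation B (T b) b)"

definition star_ricci ::
  "'a::euclidean_space set \<Rightarrow> ('a \<Rightarrow> 'a \<Rightarrow> 'a) \<Rightarrow> 'a \<Rightarrow> 'a \<Rightarrow> 'a \<Rightarrow> real" where
  "star_ricci M J p u v =
     trace_on (tangent_space M p) (\<lambda>w. - (1/2) *\<^sub>R J p (riemann M p u (J p v) w))"


section \<open>Isoparametric hypersurfaces of OT--FKM type\<close>

text \<open>The system is \<open>P 0, \<dots>, P m\<close>; values of \<open>P\<close> beyond \<open>m\<close> are irrelevant.\<close>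

definition clifford_system :: "nat \<Rightarrow> (nat \<Rightarrow> real^'n^'n) \<Rightarrow> bool" where
  "clifford_system m P \<longleftrightarrow>
     (\<forall>i\<le>m. transpose (P i) = P i \<and> orthogonal_matrix (P i)) \<and>
     (\<forall>i\<le>m. \<forall>j\<le>m. P i ** P j + P j ** P i = (if i = j then 2 else 0) *\<^sub>R mat 1)"

definition fkm_poly :: "nat \<Rightarrow> (nat \<Rightarrow> real^'n^'n) \<Rightarrow> real^'n \<Rightarrow> real" where
  "fkm_poly m P x = norm x ^ 4 - 2 * (\<Sum>i\<le>m. ((P i *v x) \<bullet> x)\<^sup>2)"

definition fkm_hypersurface :: "nat \<Rightarrow> (nat \<Rightarrow> real^'n^'n) \<Rightarrow> real \<Rightarrow> (real^'n) set" where
  "fkm_hypersurface m P \<theta> = {x \<in> sphere 0 1. fkm_poly m P x = cos (4 * \<theta>)}"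

definition fkm_normal :: "nat \<Rightarrow> (nat \<Rightarrow> real^'n^'n) \<Rightarrow> real^'n \<Rightarrow> real^'n" where
  "fkm_normal m P x =
     (let w = gradient_on (sphere 0 1) (fkm_poly m P) x in w /\<^sub>R norm w)"

definition shape_operator ::
  "nat \<Rightarrow> (nat \<Rightarrow> real^'n^'n) \<Rightarrow> real \<Rightarrow> real^'n \<Rightarrow> real^'n \<Rightarrow> real^'n" where
  "shape_operator m P \<theta> x v = - differential (fkm_hypersurface m P \<theta>) (fkm_normal m P) x v"

definition principal_curvature :: "real \<Rightarrow> nat \<Rightarrow> real" where
  "principal_curvature \<theta> k = cot (\<theta> + (real k - 1) / 4 * pi)"

definition principal_distribution ::
  "nat \<Rightarrow> (nat \<Rightarrow> real^'n^'n) \<Rightarrow> real \<Rightarrow> nat \<Rightarrow> real^'n \<Rightarrow> (real^'n) set" where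
  "principal_distribution m P \<theta> k x =
     {v \<in> tangent_space (fkm_hypersurface m P \<theta>) x.
        shape_operator m P \<theta> x v = principal_curvature \<theta> k *\<^sub>R v}"

end

theory Submission
  imports Defs
begin

text \<open>
  Let \<open>A\<close> be the shape operator of the hypersurface. The Gauss equation in the unit sphere,
  \<open>R(u,v)w = \<langle>u,w\<rangle>v - \<langle>v,w\<rangle>u + \<langle>Au,w\<rangle>Av - \<langle>Av,w\<rangle>Au\<close>, makes \<open>w \<mapsto> J(R(u,Jv)w)\<close> a sum of
  four maps of rank one, and taking the trace gives \<open>*Ric(u,v) = \<langle>u,v\<rangle> - \<langle>u,AJAJv\<rangle>\<close>. So it suffices
  that \<open>AJAJ\<close> is the identity (\<open>star_ricci_eq_0\<close>). On an eigenvector of \<open>A\<close> for \<open>\<lambda>\<^sub>k\<close> that \<open>J\<close> maps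
  to an eigenvector for \<open>\<lambda>\<^sub>l\<close>, the operator \<open>AJAJ\<close> is multiplication by \<open>-\<lambda>\<^sub>k\<lambda>\<^sub>l\<close>, and
  \<open>\<lambda>\<^sub>1\<lambda>\<^sub>3 = \<lambda>\<^sub>2\<lambda>\<^sub>4 = -1\<close> because the cotangents of \<open>\<phi>\<close> and \<open>\<phi> + \<pi>/2\<close> have product \<open>-1\<close>. As the
  four principal distributions span the tangent space, the statement follows once \<open>J\<close> is known to
  map the first two \<^emph>\<open>onto\<close> the last two, which is a comparison of dimensions.
  
  The geometry enters in two ways. First, the curvature is defined through a Levi-Civita connection
  that is merely chosen, so existence and uniqueness are part of the proof: the tangential part of
  the ambient derivative is such a connection, the Koszul argument gives uniqueness, and
  differentiating twice gives the Gauss equation (\<open>gauss_equation\<close>). The point \<open>p\<close> and a unit normal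
  \<open>\<xi>\<close> in the sphere form a normal frame on the whole hypersurface; for the OT--FKM
  hypersurfaces \<open>\<xi>\<close> is even a polynomial map on the ambient space.
  
  Secondly, the tangent spaces and the eigenspaces of \<open>A\<close> have to be computed. Write \<open>s = sin 2\<theta>\<close>,
  \<open>c = cos 2\<theta>\<close>, and let \<open>N\<close> be the element of the Clifford sphere with coordinates
  \<open>\<langle>P\<^sub>i x,x\<rangle> / s\<close>. The hypersurface consists of the unit vectors with
  \<open>\<Sum>\<^sub>i \<langle>P\<^sub>i x,x\<rangle>\<^sup>2 = s\<^sup>2\<close>. Rescaling the two components of a vector in the eigenspaces of \<open>N\<close> moves it
  onto the hypersurface (\<open>retraction_in_M\<close>), which produces enough curves to find the tangent spaces.
  With \<open>S\<close> the orthogonal projection onto the span of the vectors \<open>P\<^sub>i x\<close> one finds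
  \<open>c A = N + (2/s) S - s\<close>; from \<open>N\<^sup>2 = 1\<close>, \<open>S\<^sup>2 = S\<close> and \<open>SNS = -s S\<close> on tangent vectors it follows that
  \<open>A\<close> is annihilated by the product of \<open>(t - \<lambda>\<^sub>1)(t - \<lambda>\<^sub>3)\<close> and \<open>(t - \<lambda>\<^sub>2)(t - \<lambda>\<^sub>4)\<close>, hence
  diagonalisable (\<open>weingarten_quartic\<close>, \<open>tangent_space_eq_sum\<close>). Instead of the individual
  multiplicities only an inertia estimate is used: \<open>A\<close> is positive on the fixed vectors of \<open>N\<close>, which
  fill half of the tangent space, so the negative eigenspaces take up at most half of it
  (\<open>dim_neg_le_pos\<close>).
\<close>

section \<open>Smooth maps on open subsets of a Euclidean space\<close>

abbreviation D :: "('a::real_normed_vector \<Rightarrow> 'b::real_normed_vector) \<Rightarrow> 'a \<Rightarrow> 'a \<Rightarrow> 'b" where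
  "D f x \<equiv> frechet_derivative f (at x)"

lemma D_eq: "(f has_derivative f') (at x) \<Longrightarrow> D f x = f'"
  using frechet_derivative_at by metis

lemma Ck_on_Suc_imp: "Ck_on (Suc n) U f \<Longrightarrow> Ck_on n U f"
proof (induction n arbitrary: f)
  case 0
  then show ?case
    by (auto intro!: continuous_at_imp_continuous_on differentiable_imp_continuous_within)
qed auto

text \<open>
  Needed because the derivative of a sum or product is given by the usual formula only on the open
  set where the factors are differentiable, whereas \<open>frechet_derivative\<close> is a total function.
\<close>

lemma Ck_on_cong:
  assumes "open U" "\<And>x. x \<in> U \<Longrightarrow> f x = g x" "Ck_on n U f"
  shows "Ck_on n U g"
  using assms(2,3)
proof (induction n arbitrary: f g)
  case 0
  then show ?case using continuous_on_cong by (metis Ck_on.simps(1))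
next
  case (Suc n)
  have d: "(g has_derivative D f x) (at x)" if "x \<in> U" for x
  proof (rule has_derivative_transform_within_open)
    show "(f has_derivative D f x) (at x)"
      using Suc.prems(2) that by (simp flip: frechet_derivative_works)
  qed (use that assms(1) Suc.prems in auto)
  have "Ck_on n U (\<lambda>x. D g x v)" for v
  proof (rule Suc.IH[of "\<lambda>x. D f x v"])
    show "D f x v = D g x v" if "x \<in> U" for x using D_eq[OF d[OF that]] by simp
  qed (use Suc.prems in auto)
  then show ?case using d by (auto simp: differentiable_def)
qed

lemma Ck_on_const: "Ck_on n U (\<lambda>x. c)"
  by (induction n arbitrary: c) auto

lemma Ck_on_bounded_linear: "bounded_linear f \<Longrightarrow> Ck_on n U f"
proof (cases n)
  case (Suc k)
  assume f: "bounded_linear f"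
  have "D f x = f" for x using D_eq bounded_linear_imp_has_derivative[OF f] by blast
  then show ?thesis using f Suc by (auto simp: Ck_on_const bounded_linear_imp_differentiable)
qed (simp add: linear_continuous_on)

lemma Ck_on_add:
  assumes "open U" "Ck_on n U f" "Ck_on n U g"
  shows "Ck_on n U (\<lambda>x. f x + g x)"
  using assms(2,3)
proof (induction n arbitrary: f g)
  case (Suc n)
  have d: "((\<lambda>x. f x + g x) has_derivative (\<lambda>v. D f x v + D g x v)) (at x)" if "x \<in> U" for x
    using Suc.prems that by (intro has_derivative_add) (auto simp flip: frechet_derivative_works)
  have "Ck_on n U (\<lambda>x. D (\<lambda>x. f x + g x) x v)" for v
  proof (rule Ck_on_cong[OF assms(1), of "\<lambda>x. D f x v + D g x v"])
    show "D f x v + D g x v = D (\<lambda>x. f x + g x) x v" if "x \<in> U" for x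
      using D_eq[OF d[OF that]] by simp
  qed (use Suc in auto)
  then show ?case using d by (auto simp: differentiable_def)
qed (auto intro: continuous_on_add)

lemma Ck_on_bilinear:
  assumes "bounded_bilinear B" "open U" "Ck_on n U f" "Ck_on n U g"
  shows "Ck_on n U (\<lambda>x. B (f x) (g x))"
  using assms(3,4)
proof (induction n arbitrary: f g)
  case 0
  then show ?case using bounded_bilinear.continuous_on[OF assms(1)] by auto
next
  case (Suc n)
  have d: "((\<lambda>x. B (f x) (g x)) has_derivative (\<lambda>v. B (f x) (D g x v) + B (D f x v) (g x))) (at x)"
    if "x \<in> U" for x
    using Suc.prems that
    by (intro bounded_bilinear.FDERIV[OF assms(1)]) (auto simp flip: frechet_derivative_works)
  have "Ck_on n U (\<lambda>x. D (\<lambda>x. B (f x) (g x)) x v)" for v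
  proof (rule Ck_on_cong[OF assms(2)])
    show "Ck_on n U (\<lambda>x. B (f x) (D g x v) + B (D f x v) (g x))"
      using Suc.prems Suc.prems[THEN Ck_on_Suc_imp] by (intro Ck_on_add Suc.IH assms) auto
    show "B (f x) (D g x v) + B (D f x v) (g x) = D (\<lambda>x. B (f x) (g x)) x v" if "x \<in> U" for x
      using D_eq[OF d[OF that]] by simp
  qed
  then show ?case using d by (auto simp: differentiable_def)
qed

lemma smooth_on_subset:
  assumes "smooth_on U f" "V \<subseteq> U"
  shows "smooth_on V f"
proof -
  have "Ck_on n U f \<Longrightarrow> Ck_on n V f" for n and f :: "'a \<Rightarrow> 'b"
    using assms(2) by (induction n arbitrary: f) (auto intro: continuous_on_subset)
  with assms(1) show ?thesis by (simp add: smooth_on_def)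
qed

lemma smooth_on_has_derivative:
  "smooth_on U f \<Longrightarrow> x \<in> U \<Longrightarrow> (f has_derivative D f x) (at x)"
  unfolding smooth_on_def frechet_derivative_works[symmetric] by (metis Ck_on.simps(2))

lemma smooth_on_D_const: "smooth_on U f \<Longrightarrow> smooth_on U (\<lambda>x. D f x v)"
  unfolding smooth_on_def by (metis Ck_on.simps(2))

lemma smooth_on_continuous: "smooth_on U f \<Longrightarrow> continuous_on U f"
  unfolding smooth_on_def by (metis Ck_on.simps(1))

lemma smooth_on_const: "smooth_on U (\<lambda>x. c)"
  by (simp add: smooth_on_def Ck_on_const)

lemma smooth_on_linear: "linear f \<Longrightarrow> smooth_on U f"
  by (simp add: smooth_on_def Ck_on_bounded_linear linear_conv_bounded_linear)

lemma smooth_on_add: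
  "open U \<Longrightarrow> smooth_on U f \<Longrightarrow> smooth_on U g \<Longrightarrow> smooth_on U (\<lambda>x. f x + g x)"
  by (simp add: smooth_on_def Ck_on_add)

lemma smooth_on_bilinear:
  "bounded_bilinear B \<Longrightarrow> open U \<Longrightarrow> smooth_on U f \<Longrightarrow> smooth_on U g
    \<Longrightarrow> smooth_on U (\<lambda>x. B (f x) (g x))"
  by (simp add: smooth_on_def Ck_on_bilinear)

lemmas smooth_on_scaleR = smooth_on_bilinear[OF bounded_bilinear_scaleR]
lemmas smooth_on_inner = smooth_on_bilinear[OF bounded_bilinear_inner]

lemma smooth_on_sum:
  assumes "open U" "\<And>i. i \<in> I \<Longrightarrow> smooth_on U (f i)"
  shows "smooth_on U (\<lambda>x. \<Sum>i\<in>I. f i x)"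
  using assms(2)
  by (induction I rule: infinite_finite_induct)
    (auto intro: smooth_on_const smooth_on_add[OF assms(1)])

lemma linear_basis_expansion:
  fixes L :: "'a::euclidean_space \<Rightarrow> 'b::real_vector"
  assumes "linear L"
  shows "L v = (\<Sum>b\<in>Basis. (v \<bullet> b) *\<^sub>R L b)"
  by (subst (1) euclidean_representation[of v, symmetric])
    (simp add: linear_sum[OF assms] linear_scale[OF assms] del: euclidean_representation)

lemma smooth_on_cong:
  "open U \<Longrightarrow> (\<And>x. x \<in> U \<Longrightarrow> f x = g x) \<Longrightarrow> smooth_on U f \<Longrightarrow> smooth_on U g"
  unfolding smooth_on_def using Ck_on_cong by blast

lemma smooth_on_linear_D: "smooth_on U f \<Longrightarrow> x \<in> U \<Longrightarrow> linear (D f x)"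
  using has_derivative_linear smooth_on_has_derivative by blast

text \<open>
  Linearity in the direction reduces a varying direction to the finitely many basis directions, for
  which smoothness of the derivative is part of the definition.
\<close>

lemma smooth_on_D:
  assumes "open U" "smooth_on U f" "smooth_on U Y"
  shows "smooth_on U (\<lambda>x. D f x (Y x))"
proof (rule smooth_on_cong[OF assms(1)])
  show "smooth_on U (\<lambda>x. \<Sum>b\<in>Basis. (Y x \<bullet> b) *\<^sub>R D f x b)"
    by (intro smooth_on_sum smooth_on_scaleR smooth_on_inner smooth_on_const smooth_on_D_const assms)
qed (use linear_basis_expansion smooth_on_linear_D assms(2) in metis)

text \<open>
  The product rule for the pairing of the derivative of \<open>f\<close> with a direction field \<open>Y\<close>. The second
  summand is the second derivative of \<open>f\<close> in the directions \<open>Y p\<close> and \<open>u\<close>; its symmetry makes it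
  disappear from commutators.
\<close>

lemma has_derivative_D_along:
  assumes "open U" "smooth_on U f" "smooth_on U Y" "p \<in> U"
  shows "((\<lambda>x. D f x (Y x)) has_derivative
    (\<lambda>u. D f p (D Y p u) + D (\<lambda>x. D f x (Y p)) p u)) (at p)"
proof -
  have fb: "((\<lambda>x. D f x b) has_derivative D (\<lambda>x. D f x b) p) (at p)" for b
    using assms smooth_on_D_const smooth_on_has_derivative by blast
  have Y: "(Y has_derivative D Y p) (at p)"
    using assms smooth_on_has_derivative by blast
  have sum: "((\<lambda>x. \<Sum>b\<in>Basis. (g x \<bullet> b) *\<^sub>R D f x b) has_derivative
      (\<lambda>u. \<Sum>b\<in>Basis. (g p \<bullet> b) *\<^sub>R D (\<lambda>x. D f x b) p u + (g' u \<bullet> b) *\<^sub>R D f p b)) (at p)"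
    if "(g has_derivative g') (at p)" for g g'
    by (intro has_derivative_sum has_derivative_scaleR fb has_derivative_inner_left that)
  have exp: "D f x w = (\<Sum>b\<in>Basis. (w \<bullet> b) *\<^sub>R D f x b)" if "x \<in> U" for x w
    using linear_basis_expansion smooth_on_linear_D assms(2) that by blast
  have der: "((\<lambda>x. D f x (g x)) has_derivative
      (\<lambda>u. (\<Sum>b\<in>Basis. (g p \<bullet> b) *\<^sub>R D (\<lambda>x. D f x b) p u) + D f p (g' u))) (at p)"
    if "(g has_derivative g') (at p)" for g g'
    using has_derivative_transform_within_open[OF sum[OF that] assms(1,4), of "\<lambda>x. D f x (g x)"] exp
    by (simp add: sum.distrib exp[OF assms(4), of "g' _"])
  have "D (\<lambda>x. D f x (Y p)) p u = (\<Sum>b\<in>Basis. (Y p \<bullet> b) *\<^sub>R D (\<lambda>x. D f x b) p u)" for u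
    using D_eq[OF der[OF has_derivative_const[of "Y p"]]] linear_0[OF smooth_on_linear_D[OF assms(2,4)]]
    by simp
  with der[OF Y] show ?thesis by (simp add: add.commute)
qed

section \<open>Symmetry of the second derivative\<close>

text \<open>
  The mean value theorem in direction \<open>u\<close>, applied to the increment of \<open>f\<close> in direction \<open>v\<close>, and then
  in direction \<open>v\<close>. The left-hand side is symmetric in \<open>u\<close> and \<open>v\<close>, which is what proves the symmetry
  of the second derivative.
\<close>

lemma second_difference:
  fixes f :: "'a::euclidean_space \<Rightarrow> real"
  assumes sub: "ball p d \<subseteq> U" and f: "smooth_on U f"
    and t: "0 < t" "t * (norm u + norm v) < d"
  shows "\<exists>a b. 0 < a \<and> a < t \<and> 0 < b \<and> b < t \<and>
    f (p + t *\<^sub>R u + t *\<^sub>R v) - f (p + t *\<^sub>R u) - f (p + t *\<^sub>R v) + f p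
      = t * t * D (\<lambda>x. D f x u) (p + a *\<^sub>R u + b *\<^sub>R v) v"
proof -
  have inU: "p + a *\<^sub>R u + b *\<^sub>R v \<in> U" if "0 \<le> a" "a \<le> t" "0 \<le> b" "b \<le> t" for a b
  proof -
    have "norm (a *\<^sub>R u + b *\<^sub>R v) \<le> a * norm u + b * norm v"
      using norm_triangle_ineq[of "a *\<^sub>R u" "b *\<^sub>R v"] that by simp
    also have "\<dots> \<le> t * norm u + t * norm v"
      using that by (intro add_mono mult_right_mono) auto
    also have "\<dots> < d" using t by (simp add: algebra_simps)
    finally have "p + (a *\<^sub>R u + b *\<^sub>R v) \<in> ball p d"
      by (subst mem_ball, subst dist_commute) (simp add: dist_norm)
    then show ?thesis using sub by (auto simp: add.assoc)
  qed
  have line: "DERIV (\<lambda>r. g (x + r *\<^sub>R w)) r :> D g (x + r *\<^sub>R w) w"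
    if "smooth_on U g" "x + r *\<^sub>R w \<in> U" for g :: "'a \<Rightarrow> real" and x w r
  proof -
    have "((\<lambda>r. x + r *\<^sub>R w) has_derivative (\<lambda>h. h *\<^sub>R w)) (at r)"
      by (auto intro!: derivative_eq_intros)
    from has_derivative_compose[OF this smooth_on_has_derivative[OF that]]
    have "((\<lambda>r. g (x + r *\<^sub>R w)) has_derivative (\<lambda>h. D g (x + r *\<^sub>R w) (h *\<^sub>R w))) (at r)" .
    moreover have "(\<lambda>h. D g (x + r *\<^sub>R w) (h *\<^sub>R w)) = (*) (D g (x + r *\<^sub>R w) w)"
      using linear_scale[OF smooth_on_linear_D[OF that]] by (auto simp: mult.commute)
    ultimately show ?thesis by (simp add: has_field_derivative_def)
  qed
  have "\<exists>a>0. a < t \<and>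
      (f (p + t *\<^sub>R v + t *\<^sub>R u) - f (p + t *\<^sub>R u)) - (f (p + t *\<^sub>R v + 0 *\<^sub>R u) - f (p + 0 *\<^sub>R u))
      = (t - 0) * (D f (p + t *\<^sub>R v + a *\<^sub>R u) u - D f (p + a *\<^sub>R u) u)"
    by (rule MVT2[OF t(1)], rule DERIV_diff; rule line[OF f])
      (use inU[of _ t] inU[of _ 0] t in \<open>auto simp: algebra_simps\<close>)
  then obtain a where a: "0 < a" "a < t"
    "f (p + t *\<^sub>R v + t *\<^sub>R u) - f (p + t *\<^sub>R u) - (f (p + t *\<^sub>R v) - f p)
      = t * (D f (p + t *\<^sub>R v + a *\<^sub>R u) u - D f (p + a *\<^sub>R u) u)"
    by auto
  have "\<exists>b>0. b < t \<and> D f (p + a *\<^sub>R u + t *\<^sub>R v) u - D f (p + a *\<^sub>R u + 0 *\<^sub>R v) u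
      = (t - 0) * D (\<lambda>x. D f x u) (p + a *\<^sub>R u + b *\<^sub>R v) v"
    by (rule MVT2[OF t(1)], rule line[OF smooth_on_D_const[OF f]])
      (use inU[of a] a in auto)
  then obtain b where "0 < b" "b < t" "D f (p + a *\<^sub>R u + t *\<^sub>R v) u - D f (p + a *\<^sub>R u) u
      = t * D (\<lambda>x. D f x u) (p + a *\<^sub>R u + b *\<^sub>R v) v"
    by auto
  with a show ?thesis
    by (intro exI[of _ a] exI[of _ b]) (simp add: algebra_simps)
qed

text \<open>
  Both mixed derivatives, at points arbitrarily close to \<open>p\<close>, are equal to the same second difference
  quotient; continuity carries the equality over to \<open>p\<close>.
\<close>

lemma second_derivative_symmetric_real:
  fixes f :: "'a::euclidean_space \<Rightarrow> real"
  assumes U: "open U" "p \<in> U" and f: "smooth_on U f"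
  shows "D (\<lambda>x. D f x u) p v = D (\<lambda>x. D f x v) p u"
proof (rule ccontr)
  let ?g = "\<lambda>u v x. D (\<lambda>x. D f x u) x v"
  define e where "e = \<bar>?g u v p - ?g v u p\<bar> / 2"
  assume "?g u v p \<noteq> ?g v u p"
  then have e: "e > 0" by (simp add: e_def)
  have "\<exists>d>0. \<forall>x. dist x p < d \<longrightarrow> \<bar>?g u v x - ?g u v p\<bar> < e" for u v
  proof -
    have "continuous_on U (?g u v)"
      by (intro smooth_on_continuous smooth_on_D_const f)
    then have "isCont (?g u v) p"
      using U continuous_on_eq_continuous_at by blast
    then show ?thesis using e unfolding continuous_at_eps_delta dist_real_def by blast
  qed
  then obtain d1 d2 where d: "d1 > 0" "d2 > 0"
    "\<And>x. dist x p < d1 \<Longrightarrow> \<bar>?g u v x - ?g u v p\<bar> < e"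
    "\<And>x. dist x p < d2 \<Longrightarrow> \<bar>?g v u x - ?g v u p\<bar> < e" by metis
  obtain d3 where d3: "d3 > 0" "ball p d3 \<subseteq> U" using U open_contains_ball by blast
  define \<delta> where "\<delta> = min d1 (min d2 d3)"
  \<comment> \<open>the summand 1 only prevents a division by 0 for \<open>u = v = 0\<close>\<close>
  define t where "t = \<delta> / (2 * (norm u + norm v + 1))"
  have pos: "\<delta> > 0" "norm u + norm v + 1 > 0" "norm u + norm v \<ge> 0"
    using d d3 by (auto simp: \<delta>_def intro: add_nonneg_pos)
  have t: "t > 0"
    unfolding t_def using pos(1,2) zero_less_numeral by (intro divide_pos_pos mult_pos_pos)
  have "t * (norm u + norm v) < t * (2 * (norm u + norm v + 1))"
  proof (rule mult_strict_left_mono[OF _ t])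
    show "norm u + norm v < 2 * (norm u + norm v + 1)"
      using pos(3) unfolding distrib_left by linarith
  qed
  also have "\<dots> = \<delta>"
    unfolding t_def by (rule nonzero_eq_divide_eq[THEN iffD1, OF _ refl]) (use pos(2) in argo)
  finally have small: "t * (norm u + norm v) < \<delta>" .
  have near: "dist (p + a *\<^sub>R w + b *\<^sub>R z) p < \<delta>"
    if "0 < a" "a < t" "0 < b" "b < t" "norm w + norm z = norm u + norm v" for a b w z
  proof -
    have "dist (p + a *\<^sub>R w + b *\<^sub>R z) p \<le> a * norm w + b * norm z"
      using norm_triangle_ineq[of "a *\<^sub>R w" "b *\<^sub>R z"] that by (simp add: dist_norm add.assoc)
    also have "\<dots> \<le> t * norm w + t * norm z"
      using that by (intro add_mono mult_right_mono) auto
    also have "\<dots> = t * (norm u + norm v)" using that(5) by (metis distrib_left)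
    finally show ?thesis using small by simp
  qed
  have sub: "ball p \<delta> \<subseteq> U" using d3 by (auto simp: \<delta>_def)
  obtain a b where ab: "0 < a" "a < t" "0 < b" "b < t"
    "f (p + t *\<^sub>R u + t *\<^sub>R v) - f (p + t *\<^sub>R u) - f (p + t *\<^sub>R v) + f p
      = t * t * ?g u v (p + a *\<^sub>R u + b *\<^sub>R v)"
    using second_difference[OF sub f t small] by blast
  obtain a' b' where ab': "0 < a'" "a' < t" "0 < b'" "b' < t"
    "f (p + t *\<^sub>R v + t *\<^sub>R u) - f (p + t *\<^sub>R v) - f (p + t *\<^sub>R u) + f p
      = t * t * ?g v u (p + a' *\<^sub>R v + b' *\<^sub>R u)"
    using second_difference[OF sub f t, of v u] small by (auto simp: add.commute)
  have "f (p + t *\<^sub>R u + t *\<^sub>R v) = f (p + t *\<^sub>R v + t *\<^sub>R u)" by (simp add: ac_simps)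
  then have "t * t * ?g u v (p + a *\<^sub>R u + b *\<^sub>R v) = t * t * ?g v u (p + a' *\<^sub>R v + b' *\<^sub>R u)"
    using ab(5) ab'(5) by linarith
  then have eq: "?g u v (p + a *\<^sub>R u + b *\<^sub>R v) = ?g v u (p + a' *\<^sub>R v + b' *\<^sub>R u)"
    using t by simp
  have "\<bar>?g u v (p + a *\<^sub>R u + b *\<^sub>R v) - ?g u v p\<bar> < e"
    using near[OF ab(1-4), of u v] by (intro d) (simp add: \<delta>_def)
  moreover have "\<bar>?g v u (p + a' *\<^sub>R v + b' *\<^sub>R u) - ?g v u p\<bar> < e"
    using near[OF ab'(1-4), of v u] by (intro d) (simp add: \<delta>_def add.commute)
  ultimately show False using eq unfolding e_def by argo
qed

lemma second_derivative_symmetric: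
  fixes f :: "'a::euclidean_space \<Rightarrow> 'b::euclidean_space"
  assumes U: "open U" "p \<in> U" and f: "smooth_on U f"
  shows "D (\<lambda>x. D f x u) p v = D (\<lambda>x. D f x v) p u"
proof (rule euclidean_eqI)
  fix b :: 'b
  assume "b \<in> Basis"
  let ?h = "\<lambda>x. f x \<bullet> b"
  have h: "smooth_on U ?h" by (intro smooth_on_inner U f smooth_on_const)
  have inner: "D (\<lambda>x. g x \<bullet> b) x w = D g x w \<bullet> b"
    if "smooth_on U g" "x \<in> U" for g :: "'a \<Rightarrow> 'b" and x w
    using D_eq[OF has_derivative_inner_left[OF smooth_on_has_derivative[OF that]]] by simp
  have "D (\<lambda>x. D ?h x w) p z = D (\<lambda>x. D f x w) p z \<bullet> b" for w z
  proof -
    have "((\<lambda>x. D ?h x w) has_derivative (\<lambda>z. D (\<lambda>x. D f x w) p z \<bullet> b)) (at p)"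
    proof (rule has_derivative_transform_within_open[OF _ U])
      show "((\<lambda>x. D f x w \<bullet> b) has_derivative (\<lambda>z. D (\<lambda>x. D f x w) p z \<bullet> b)) (at p)"
        by (intro has_derivative_inner_left smooth_on_has_derivative[of U] smooth_on_D_const f U)
    qed (simp add: inner[OF f])
    then show ?thesis using D_eq by metis
  qed
  then show "D (\<lambda>x. D f x u) p v \<bullet> b = D (\<lambda>x. D f x v) p u \<bullet> b"
    using second_derivative_symmetric_real[OF U h, of u v] by simp
qed

section \<open>Calculus on a subset of a Euclidean space\<close>

text \<open>
  The derivative within \<open>M\<close> need not be unique, but on a velocity of a curve in \<open>M\<close> any two candidates
  agree by the chain rule. Hence the differential can be computed from any differentiable extension.
\<close>

lemma differential_eq:
  fixes f :: "'a::euclidean_space \<Rightarrow> 'b::real_normed_vector"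
  assumes h: "(h has_derivative h') (at p)" and U: "open U" "p \<in> U" and p: "p \<in> M"
    and eq: "\<And>q. q \<in> M \<Longrightarrow> q \<in> U \<Longrightarrow> f q = h q" and v: "v \<in> tangent_space M p"
  shows "differential M f p v = h' v"
proof -
  obtain d where d: "d > 0" "ball p d \<subseteq> U" using U open_contains_ball by blast
  have fh: "(f has_derivative h') (at p within M)"
  proof (rule has_derivative_transform_within[OF has_derivative_at_withinI[OF h] d(1) p])
    fix x assume "x \<in> M" "dist x p < d"
    then show "h x = f x" using eq d(2) by (metis dist_commute mem_ball subsetD)
  qed
  then have fD: "(f has_derivative differential M f p) (at p within M)"
    unfolding differential_def[abs_def] using frechet_derivative_works differentiableI by blast
  obtain \<gamma> e where \<gamma>: "e > 0" "\<And>t. \<bar>t\<bar> < e \<Longrightarrow> \<gamma> t \<in> M" "\<gamma> 0 = p"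
    "(\<gamma> has_vector_derivative v) (at (0::real))"
    using v unfolding tangent_space_def by blast
  let ?I = "{-e<..<e}"
  have chain: "((f \<circ> \<gamma>) has_vector_derivative L v) (at 0)"
    if L: "(f has_derivative L) (at p within M)" for L
  proof -
    \<comment> \<open>The curve stays in \<open>M\<close> only near 0, so the chain rule is applied within an open interval.\<close>
    have "(\<gamma> has_derivative (\<lambda>t. t *\<^sub>R v)) (at 0 within ?I)"
      using \<gamma>(4) has_derivative_at_withinI by (auto simp: has_vector_derivative_def)
    moreover have "(f has_derivative L) (at (\<gamma> 0) within \<gamma> ` ?I)"
      by (rule has_derivative_subset) (use L \<gamma> in auto)
    ultimately have "((f \<circ> \<gamma>) has_derivative (L \<circ> (\<lambda>t. t *\<^sub>R v))) (at 0 within ?I)"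
      by (rule diff_chain_within)
    then have "((f \<circ> \<gamma>) has_derivative (L \<circ> (\<lambda>t. t *\<^sub>R v))) (at 0)"
      using \<gamma>(1) at_within_open[of 0 ?I] by auto
    moreover have "L \<circ> (\<lambda>t. t *\<^sub>R v) = (\<lambda>t. t *\<^sub>R L v)"
      using linear_scale[OF has_derivative_linear[OF L]] by auto
    ultimately show ?thesis by (simp add: has_vector_derivative_def)
  qed
  show ?thesis
    using vector_derivative_unique_at[OF chain[OF fD] chain[OF fh]] .
qed

lemma smooth_map_extension:
  assumes "smooth_map M f" "p \<in> M"
  obtains U h where "open U" "p \<in> U" "smooth_on U h" "\<And>q. q \<in> M \<Longrightarrow> q \<in> U \<Longrightarrow> f q = h q"
    "\<And>q v. q \<in> M \<Longrightarrow> q \<in> U \<Longrightarrow> v \<in> tangent_space M q \<Longrightarrow> differential M f q v = D h q v"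
proof -
  obtain U h where Uh: "open U" "p \<in> U" "smooth_on U h" "\<forall>q\<in>M \<inter> U. f q = h q"
    using assms unfolding smooth_map_def by blast
  show ?thesis
  proof (rule that[OF Uh(1-3)])
    fix q v assume q: "q \<in> M" "q \<in> U" "v \<in> tangent_space M q"
    show "differential M f q v = D h q v"
      by (rule differential_eq[OF smooth_on_has_derivative[OF Uh(3)] Uh(1)]) (use q Uh in auto)
  qed (use Uh in auto)
qed

text \<open>
  Two smooth maps have extensions to a common neighbourhood, so that operations on maps can be
  carried out on extensions.
\<close>

lemma smooth_map_extension2:
  assumes "smooth_map M f" "smooth_map M g" "p \<in> M"
  obtains U h k where "open U" "p \<in> U" "smooth_on U h" "smooth_on U k"
    "\<And>q. q \<in> M \<Longrightarrow> q \<in> U \<Longrightarrow> f q = h q" "\<And>q. q \<in> M \<Longrightarrow> q \<in> U \<Longrightarrow> g q = k q"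
    "\<And>q v. q \<in> M \<Longrightarrow> q \<in> U \<Longrightarrow> v \<in> tangent_space M q \<Longrightarrow> differential M f q v = D h q v"
    "\<And>q v. q \<in> M \<Longrightarrow> q \<in> U \<Longrightarrow> v \<in> tangent_space M q \<Longrightarrow> differential M g q v = D k q v"
proof -
  obtain U h where U: "open U" "p \<in> U" "smooth_on U h" "\<And>q. q \<in> M \<Longrightarrow> q \<in> U \<Longrightarrow> f q = h q"
    "\<And>q v. q \<in> M \<Longrightarrow> q \<in> U \<Longrightarrow> v \<in> tangent_space M q \<Longrightarrow> differential M f q v = D h q v"
    using smooth_map_extension[OF assms(1,3)] by metis
  obtain V k where V: "open V" "p \<in> V" "smooth_on V k" "\<And>q. q \<in> M \<Longrightarrow> q \<in> V \<Longrightarrow> g q = k q"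
    "\<And>q v. q \<in> M \<Longrightarrow> q \<in> V \<Longrightarrow> v \<in> tangent_space M q \<Longrightarrow> differential M g q v = D k q v"
    using smooth_map_extension[OF assms(2,3)] by metis
  show ?thesis
    by (rule that[of "U \<inter> V" h k])
      (use U V smooth_on_subset[of U h "U \<inter> V"] smooth_on_subset[of V k "U \<inter> V"] in auto)
qed

lemma smooth_mapI:
  assumes "\<And>p. p \<in> M \<Longrightarrow> \<exists>U h. open U \<and> p \<in> U \<and> smooth_on U h \<and> (\<forall>q. q \<in> M \<longrightarrow> q \<in> U \<longrightarrow> f q = h q)"
  shows "smooth_map M f"
  unfolding smooth_map_def using assms by (metis IntE)

lemma smooth_on_imp_smooth_map: "smooth_on UNIV f \<Longrightarrow> smooth_map M f"
  unfolding smooth_map_def by blast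

lemma smooth_map_const: "smooth_map M (\<lambda>x. c)"
  by (intro smooth_on_imp_smooth_map smooth_on_const)

lemma smooth_map_ident: "smooth_map M (\<lambda>x. x)"
  by (intro smooth_on_imp_smooth_map smooth_on_linear linear_id[unfolded id_def])

lemma smooth_map_bilinear:
  assumes "bounded_bilinear B" "smooth_map M f" "smooth_map M g"
  shows "smooth_map M (\<lambda>x. B (f x) (g x))"
proof (rule smooth_mapI)
  fix p assume "p \<in> M"
  from smooth_map_extension2[OF assms(2,3) this] obtain U h k where
    "open U" "p \<in> U" "smooth_on U h" "smooth_on U k"
    "\<And>q. q \<in> M \<Longrightarrow> q \<in> U \<Longrightarrow> f q = h q" "\<And>q. q \<in> M \<Longrightarrow> q \<in> U \<Longrightarrow> g q = k q" by metis
  then show "\<exists>U h. open U \<and> p \<in> U \<and> smooth_on U h \<and> (\<forall>q. q \<in> M \<longrightarrow> q \<in> U \<longrightarrow> B (f q) (g q) = h q)"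
    by (intro exI[of _ U] exI[of _ "\<lambda>x. B (h x) (k x)"]) (auto intro: smooth_on_bilinear[OF assms(1)])
qed

lemmas smooth_map_scaleR = smooth_map_bilinear[OF bounded_bilinear_scaleR]
lemmas smooth_map_inner = smooth_map_bilinear[OF bounded_bilinear_inner]

lemma smooth_map_add:
  assumes "smooth_map M f" "smooth_map M g"
  shows "smooth_map M (\<lambda>x. f x + g x)"
proof (rule smooth_mapI)
  fix p assume "p \<in> M"
  from smooth_map_extension2[OF assms this] obtain U h k where
    "open U" "p \<in> U" "smooth_on U h" "smooth_on U k"
    "\<And>q. q \<in> M \<Longrightarrow> q \<in> U \<Longrightarrow> f q = h q" "\<And>q. q \<in> M \<Longrightarrow> q \<in> U \<Longrightarrow> g q = k q" by metis
  then show "\<exists>U h. open U \<and> p \<in> U \<and> smooth_on U h \<and> (\<forall>q. q \<in> M \<longrightarrow> q \<in> U \<longrightarrow> f q + g q = h q)"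
    by (intro exI[of _ U] exI[of _ "\<lambda>x. h x + k x"]) (auto intro: smooth_on_add)
qed

lemma smooth_map_diff:
  assumes "smooth_map M f" "smooth_map M g"
  shows "smooth_map M (\<lambda>x. f x - g x)"
  using smooth_map_add[OF assms(1) smooth_map_scaleR[OF smooth_map_const[of M "-1"] assms(2)]] by simp

lemma differential_cong:
  assumes "smooth_map M f" "\<And>q. q \<in> M \<Longrightarrow> f q = g q" "p \<in> M" "v \<in> tangent_space M p"
  shows "differential M g p v = differential M f p v"
proof -
  obtain U h where "open U" "p \<in> U" "smooth_on U h" "\<And>q. q \<in> M \<Longrightarrow> q \<in> U \<Longrightarrow> f q = h q"
    "differential M f p v = D h p v"
    using smooth_map_extension[OF assms(1,3)] assms(3,4) by metis
  then show ?thesis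
    using differential_eq[OF smooth_on_has_derivative[of U h p], of U M g v] assms(2-4) by simp
qed

lemma differential_smooth_on:
  "smooth_on UNIV f \<Longrightarrow> p \<in> M \<Longrightarrow> v \<in> tangent_space M p \<Longrightarrow> differential M f p v = D f p v"
  by (rule differential_eq[OF smooth_on_has_derivative[of UNIV f p] open_UNIV]) auto

lemma differential_ident:
  "p \<in> M \<Longrightarrow> v \<in> tangent_space M p \<Longrightarrow> differential M (\<lambda>x. x) p v = v"
  by (rule differential_eq[OF has_derivative_ident open_UNIV]) auto

lemma differential_const_on:
  assumes "\<And>q. q \<in> M \<Longrightarrow> f q = c" "p \<in> M" "v \<in> tangent_space M p"
  shows "differential M f p v = 0"
  by (rule differential_eq[OF has_derivative_const[of c] open_UNIV]) (use assms in auto)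

lemma differential_linear:
  assumes "smooth_map M f" "p \<in> M"
  obtains L where "linear L" "\<And>v. v \<in> tangent_space M p \<Longrightarrow> differential M f p v = L v"
proof -
  obtain U h where "open U" "p \<in> U" "smooth_on U h"
    "\<And>v. v \<in> tangent_space M p \<Longrightarrow> differential M f p v = D h p v"
    using smooth_map_extension[OF assms] assms(2) by metis
  then show ?thesis using that smooth_on_linear_D by metis
qed

lemma differential_add:
  assumes "smooth_map M f" "smooth_map M g" "p \<in> M" "v \<in> tangent_space M p"
  shows "differential M (\<lambda>x. f x + g x) p v = differential M f p v + differential M g p v"
proof -
  from smooth_map_extension2[OF assms(1-3)] assms(3,4) obtain U h k where
    U: "open U" "p \<in> U" "smooth_on U h" "smooth_on U k"
    "\<And>q. q \<in> M \<Longrightarrow> q \<in> U \<Longrightarrow> f q = h q" "\<And>q. q \<in> M \<Longrightarrow> q \<in> U \<Longrightarrow> g q = k q"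
    "differential M f p v = D h p v" "differential M g p v = D k p v" by metis
  show ?thesis unfolding U(7,8)
    by (rule differential_eq[where h = "\<lambda>x. h x + k x" and h' = "\<lambda>v. D h p v + D k p v" and U = U])
      (use U assms in \<open>auto intro!: has_derivative_add smooth_on_has_derivative[of U]\<close>)
qed

lemma differential_bilinear:
  assumes B: "bounded_bilinear B"
    and "smooth_map M f" "smooth_map M g" "p \<in> M" "v \<in> tangent_space M p"
  shows "differential M (\<lambda>x. B (f x) (g x)) p v
    = B (f p) (differential M g p v) + B (differential M f p v) (g p)"
proof -
  from smooth_map_extension2[OF assms(2-4)] assms(4,5) obtain U h k where
    U: "open U" "p \<in> U" "smooth_on U h" "smooth_on U k"
    "\<And>q. q \<in> M \<Longrightarrow> q \<in> U \<Longrightarrow> f q = h q" "\<And>q. q \<in> M \<Longrightarrow> q \<in> U \<Longrightarrow> g q = k q"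
    "differential M f p v = D h p v" "differential M g p v = D k p v" by metis
  have fg: "f p = h p" "g p = k p" using U assms by auto
  show ?thesis unfolding U(7,8) fg
    by (rule differential_eq[where h = "\<lambda>x. B (h x) (k x)"
          and h' = "\<lambda>v. B (h p) (D k p v) + B (D h p v) (k p)" and U = U])
      (use U assms in \<open>auto intro!: bounded_bilinear.FDERIV[OF B] smooth_on_has_derivative[of U]\<close>)
qed

lemmas differential_scaleR = differential_bilinear[OF bounded_bilinear_scaleR]
lemmas differential_inner = differential_bilinear[OF bounded_bilinear_inner]

lemma vector_fieldD:
  assumes "X \<in> vector_fields M"
  shows "smooth_map M X" "p \<in> M \<Longrightarrow> X p \<in> tangent_space M p"
  using assms by (auto simp: vector_fields_def)

lemma smooth_map_differential:
  assumes f: "smooth_map M f" and Y: "Y \<in> vector_fields M"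
  shows "smooth_map M (\<lambda>q. differential M f q (Y q))"
proof (rule smooth_mapI)
  fix p assume "p \<in> M"
  from smooth_map_extension2[OF f vector_fieldD(1)[OF Y] this] obtain U h k where
    U: "open U" "p \<in> U" "smooth_on U h" "smooth_on U k"
    "\<And>q. q \<in> M \<Longrightarrow> q \<in> U \<Longrightarrow> Y q = k q"
    "\<And>q v. q \<in> M \<Longrightarrow> q \<in> U \<Longrightarrow> v \<in> tangent_space M q \<Longrightarrow> differential M f q v = D h q v"
    by metis
  have "differential M f q (Y q) = D h q (k q)" if "q \<in> M" "q \<in> U" for q
    using U(6)[OF that vector_fieldD(2)[OF Y that(1)]] U(5)[OF that] by simp
  with U show "\<exists>U h. open U \<and> p \<in> U \<and> smooth_on U h
      \<and> (\<forall>q. q \<in> M \<longrightarrow> q \<in> U \<longrightarrow> differential M f q (Y q) = h q)"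
    by (intro exI[of _ U] exI[of _ "\<lambda>q. D h q (k q)"]) (auto intro: smooth_on_D)
qed

text \<open>
  By \<open>has_derivative_D_along\<close> the two iterated derivatives differ in their second-order parts, which
  cancel by symmetry, and in the derivative of \<open>f\<close> along the two parts of the bracket. Tangency of the
  bracket makes the differential on the right-hand side well determined.
\<close>

lemma differential_commutator:
  fixes f :: "'a::euclidean_space \<Rightarrow> 'b::euclidean_space"
  assumes f: "smooth_map M f" and XY: "X \<in> vector_fields M" "Y \<in> vector_fields M" and p: "p \<in> M"
    and tan: "lie_bracket M X Y p \<in> tangent_space M p"
  shows "differential M (\<lambda>q. differential M f q (Y q)) p (X p)
    - differential M (\<lambda>q. differential M f q (X q)) p (Y p)
    = differential M f p (lie_bracket M X Y p)"
proof -
  obtain U h where U: "open U" "p \<in> U" "smooth_on U h"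
    "\<And>q v. q \<in> M \<Longrightarrow> q \<in> U \<Longrightarrow> v \<in> tangent_space M q \<Longrightarrow> differential M f q v = D h q v"
    using smooth_map_extension[OF f p] by metis
  from smooth_map_extension2[OF vector_fieldD(1)[OF XY(1)] vector_fieldD(1)[OF XY(2)] p]
  obtain V a b where V: "open V" "p \<in> V" "smooth_on V a" "smooth_on V b"
    "\<And>q. q \<in> M \<Longrightarrow> q \<in> V \<Longrightarrow> X q = a q" "\<And>q. q \<in> M \<Longrightarrow> q \<in> V \<Longrightarrow> Y q = b q"
    "\<And>v. v \<in> tangent_space M p \<Longrightarrow> differential M X p v = D a p v"
    "\<And>v. v \<in> tangent_space M p \<Longrightarrow> differential M Y p v = D b p v" using p by metis
  let ?W = "U \<inter> V"
  have W: "open ?W" "p \<in> ?W" "smooth_on ?W h" "smooth_on ?W a" "smooth_on ?W b"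
    using U V smooth_on_subset[of U h ?W] smooth_on_subset[of V a ?W] smooth_on_subset[of V b ?W]
    by auto
  have der: "differential M (\<lambda>q. differential M f q (Z q)) p v
      = D h p (D c p v) + D (\<lambda>q. D h q (Z p)) p v"
    if "smooth_on ?W c" "\<And>q. q \<in> M \<Longrightarrow> q \<in> V \<Longrightarrow> Z q = c q"
      "Z \<in> vector_fields M" "v \<in> tangent_space M p" for Z c v
  proof -
    have Zp: "Z p = c p" using that p V by auto
    have "differential M f q (Z q) = D h q (c q)" if "q \<in> M" "q \<in> ?W" for q
      using that U(4)[OF that(1) _ vector_fieldD(2)[OF \<open>Z \<in> vector_fields M\<close> that(1)]]
        \<open>\<And>q. q \<in> M \<Longrightarrow> q \<in> V \<Longrightarrow> Z q = c q\<close>[of q] by simp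
    from differential_eq[OF has_derivative_D_along[OF W(1,3) that(1) W(2)] W(1,2) p this that(4)]
    show ?thesis unfolding Zp .
  qed
  have T: "X p \<in> tangent_space M p" "Y p \<in> tangent_space M p"
    using XY[THEN vector_fieldD(2), OF p] .
  have "differential M f p (lie_bracket M X Y p) = D h p (D b p (X p)) - D h p (D a p (Y p))"
    using U(4)[OF p U(2) tan] linear_diff[OF smooth_on_linear_D[OF W(3,2)]] T V
    by (simp add: lie_bracket_def)
  then show ?thesis
    using der[of b Y "X p"] der[of a X "Y p"] V XY W T second_derivative_symmetric[OF W(1,2,3)]
    by simp
qed

section \<open>The Gauss equation for hypersurfaces of the unit sphere\<close>

text \<open>
  A hypersurface \<open>M\<close> of the unit sphere with a unit normal field \<open>\<xi>\<close>. The symmetry of the shape operator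
  is assumed rather than derived: for a given normal field it can be read off from a formula for the
  derivative, and it yields that brackets of vector fields are tangent.
\<close>

locale spherical_hypersurface =
  fixes M :: "'a::euclidean_space set" and \<xi> :: "'a \<Rightarrow> 'a"
  assumes smooth_normal: "smooth_map M \<xi>"
    and on_sphere: "p \<in> M \<Longrightarrow> p \<bullet> p = 1"
    and normal_unit: "p \<in> M \<Longrightarrow> \<xi> p \<bullet> \<xi> p = 1"
    and normal_orthogonal: "p \<in> M \<Longrightarrow> p \<bullet> \<xi> p = 0"
    and tangent_iff: "p \<in> M \<Longrightarrow> v \<in> tangent_space M p \<longleftrightarrow> p \<bullet> v = 0 \<and> \<xi> p \<bullet> v = 0"
    and shape_symmetric: "p \<in> M \<Longrightarrow> u \<in> tangent_space M p \<Longrightarrow> v \<in> tangent_space M p \<Longrightarrow>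
      differential M \<xi> p u \<bullet> v = u \<bullet> differential M \<xi> p v"
begin

definition shape :: "'a \<Rightarrow> 'a \<Rightarrow> 'a" where
  "shape p v = - differential M \<xi> p v"

text \<open>
  Orthogonal projection onto the tangent space. Applied to constant maps it also provides global
  vector fields with prescribed values.
\<close>

definition tproj :: "'a \<Rightarrow> 'a \<Rightarrow> 'a" where
  "tproj p v = v - (p \<bullet> v) *\<^sub>R p - (\<xi> p \<bullet> v) *\<^sub>R \<xi> p"

definition tconn :: "('a \<Rightarrow> 'a) \<Rightarrow> ('a \<Rightarrow> 'a) \<Rightarrow> 'a \<Rightarrow> 'a" where
  "tconn X Y p = tproj p (differential M Y p (X p))"

lemma subspace_tangent: "p \<in> M \<Longrightarrow> subspace (tangent_space M p)"
  by (auto simp: subspace_def tangent_iff inner_add_right)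

lemma linear_tproj: "linear (tproj p)"
  by (auto intro!: linearI simp: tproj_def inner_add_right algebra_simps)

lemma tproj_tangent: "p \<in> M \<Longrightarrow> tproj p v \<in> tangent_space M p"
  by (simp add: tangent_iff tproj_def inner_diff_right on_sphere normal_unit normal_orthogonal
      inner_commute[of "\<xi> p" p])

lemma tproj_ident: "p \<in> M \<Longrightarrow> v \<in> tangent_space M p \<Longrightarrow> tproj p v = v"
  by (simp add: tangent_iff tproj_def)

lemma tproj_normal: "p \<in> M \<Longrightarrow> tproj p p = 0" "p \<in> M \<Longrightarrow> tproj p (\<xi> p) = 0"
  by (simp_all add: tproj_def on_sphere normal_unit normal_orthogonal inner_commute[of "\<xi> p" p])

lemma tproj_inner:
  "p \<in> M \<Longrightarrow> w \<in> tangent_space M p \<Longrightarrow> tproj p v \<bullet> w = v \<bullet> w"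
  by (simp add: tangent_iff tproj_def inner_diff_left)

lemma vector_field_tproj:
  assumes "smooth_map M f"
  shows "(\<lambda>p. tproj p (f p)) \<in> vector_fields M"
proof -
  have "smooth_map M (\<lambda>p. tproj p (f p))"
    unfolding tproj_def
    by (intro smooth_map_diff smooth_map_scaleR smooth_map_inner assms smooth_normal smooth_map_ident)
  then show ?thesis by (simp add: vector_fields_def tproj_tangent)
qed

lemma vector_field_extension:
  assumes "p \<in> M" "u \<in> tangent_space M p"
  obtains X where "X \<in> vector_fields M" "X p = u"
  using that[OF vector_field_tproj[OF smooth_map_const[of M u]]] tproj_ident[OF assms] by simp

lemma differential_normal_tangent:
  assumes p: "p \<in> M" "v \<in> tangent_space M p"
  shows "differential M \<xi> p v \<in> tangent_space M p"
proof -
  have "differential M (\<lambda>q. \<xi> q \<bullet> \<xi> q) p v = 0" "differential M (\<lambda>q. q \<bullet> \<xi> q) p v = 0"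
    by (rule differential_const_on[OF _ p], simp add: normal_unit normal_orthogonal)+
  moreover have "v \<bullet> \<xi> p = 0" using p tangent_iff by (simp add: inner_commute)
  ultimately show ?thesis
    using differential_inner[OF smooth_normal smooth_normal p]
      differential_inner[OF smooth_map_ident smooth_normal p]
    by (simp add: differential_ident[OF p] tangent_iff[OF p(1)] inner_commute)
qed

lemma shape_tangent: "p \<in> M \<Longrightarrow> v \<in> tangent_space M p \<Longrightarrow> shape p v \<in> tangent_space M p"
  unfolding shape_def using subspace_neg[OF subspace_tangent differential_normal_tangent] by simp

lemma shape_self_adjoint:
  "p \<in> M \<Longrightarrow> u \<in> tangent_space M p \<Longrightarrow> v \<in> tangent_space M p \<Longrightarrow> shape p u \<bullet> v = u \<bullet> shape p v"
  by (simp add: shape_def shape_symmetric)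

text \<open>
  Differentiate \<open>\<langle>q, Y q\<rangle> = 0\<close> and \<open>\<langle>\<xi> q, Y q\<rangle> = 0\<close>. This is the Gauss formula: the second fundamental form
  is what the derivative of a tangent field has in the normal directions.
\<close>

lemma normal_components:
  assumes Y: "Y \<in> vector_fields M" and p: "p \<in> M" "v \<in> tangent_space M p"
  shows "p \<bullet> differential M Y p v = - (v \<bullet> Y p)" "\<xi> p \<bullet> differential M Y p v = shape p v \<bullet> Y p"
proof -
  have *: "q \<bullet> Y q = 0" "\<xi> q \<bullet> Y q = 0" if "q \<in> M" for q
    using vector_fieldD(2)[OF Y that] tangent_iff that by auto
  have "differential M (\<lambda>q. q \<bullet> Y q) p v = 0" "differential M (\<lambda>q. \<xi> q \<bullet> Y q) p v = 0"
    by (rule differential_const_on[OF _ p], simp add: *)+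
  then show "p \<bullet> differential M Y p v = - (v \<bullet> Y p)" "\<xi> p \<bullet> differential M Y p v = shape p v \<bullet> Y p"
    using differential_inner[OF smooth_map_ident vector_fieldD(1)[OF Y] p]
      differential_inner[OF smooth_normal vector_fieldD(1)[OF Y] p]
    by (simp_all add: differential_ident[OF p] shape_def)
qed

text \<open>
  On \<open>M\<close>, the projection subtracts terms that contain no derivative of \<open>Y\<close>. In this form the
  connection can be differentiated once more without creating further second derivatives.
\<close>

lemma tconn_eq:
  assumes Y: "Y \<in> vector_fields M" and X: "X \<in> vector_fields M" and p: "p \<in> M"
  shows "tconn X Y p
    = differential M Y p (X p) + (X p \<bullet> Y p) *\<^sub>R p - (shape p (X p) \<bullet> Y p) *\<^sub>R \<xi> p"
  using normal_components[OF Y p vector_fieldD(2)[OF X p]] by (simp add: tconn_def tproj_def)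

lemma tconn_vector_field:
  "X \<in> vector_fields M \<Longrightarrow> Y \<in> vector_fields M \<Longrightarrow> tconn X Y \<in> vector_fields M"
  unfolding tconn_def[abs_def]
  by (intro vector_field_tproj smooth_map_differential vector_fieldD(1))

lemma lie_bracket_tangent:
  assumes XY: "X \<in> vector_fields M" "Y \<in> vector_fields M" and p: "p \<in> M"
  shows "lie_bracket M X Y p \<in> tangent_space M p"
proof -
  note T = vector_fieldD(2)[OF XY(1) p] vector_fieldD(2)[OF XY(2) p]
  show ?thesis
    using normal_components[OF XY(1) p T(2)] normal_components[OF XY(2) p T(1)]
      shape_symmetric[OF p T]
    by (simp add: tangent_iff[OF p] lie_bracket_def inner_diff_right shape_def inner_commute)
qed

lemma lie_bracket_vector_field:
  assumes "X \<in> vector_fields M" "Y \<in> vector_fields M"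
  shows "lie_bracket M X Y \<in> vector_fields M"
proof -
  have "smooth_map M (lie_bracket M X Y)"
    unfolding lie_bracket_def[abs_def]
    by (intro smooth_map_diff smooth_map_differential vector_fieldD(1) assms)
  then show ?thesis using lie_bracket_tangent[OF assms] by (simp add: vector_fields_def)
qed

lemma tconn_levi_civita: "is_levi_civita M tconn"
  unfolding is_levi_civita_def affine_connection_def
proof (intro conjI ballI allI impI)
  note [simp] = linear_add[OF linear_tproj] linear_scale[OF linear_tproj] linear_diff[OF linear_tproj]
  {
    fix X X' Y Y' p
    assume XY: "X \<in> vector_fields M" "X' \<in> vector_fields M" "Y \<in> vector_fields M" "Y' \<in> vector_fields M"
      and eq: "\<forall>q\<in>M. X q = X' q \<and> Y q = Y' q" and p: "p \<in> M"
    have "differential M Y' p (X p) = differential M Y p (X p)"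
      by (rule differential_cong) (use XY eq p vector_fieldD in auto)
    then show "tconn X Y p = tconn X' Y' p" using eq p by (simp add: tconn_def)
  next
    fix X Y assume "X \<in> vector_fields M" "Y \<in> vector_fields M"
    then show "tconn X Y \<in> vector_fields M" by (rule tconn_vector_field)
  next
    fix X X' Y p
    assume XY: "X \<in> vector_fields M" "X' \<in> vector_fields M" "Y \<in> vector_fields M" and p: "p \<in> M"
    note T = vector_fieldD(2)[OF XY(1) p] vector_fieldD(2)[OF XY(2) p]
    obtain L where "linear L" "\<And>v. v \<in> tangent_space M p \<Longrightarrow> differential M Y p v = L v"
      using differential_linear[OF vector_fieldD(1)[OF XY(3)] p] by metis
    then show "tconn (\<lambda>q. X q + X' q) Y p = tconn X Y p + tconn X' Y p"
      using T subspace_add[OF subspace_tangent[OF p] T] by (simp add: tconn_def linear_add)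
  next
    fix X Y Y' p
    assume XY: "X \<in> vector_fields M" "Y \<in> vector_fields M" "Y' \<in> vector_fields M" and p: "p \<in> M"
    then show "tconn X (\<lambda>q. Y q + Y' q) p = tconn X Y p + tconn X Y' p"
      by (simp add: tconn_def differential_add vector_fieldD)
  next
    fix h :: "'a \<Rightarrow> real" and X Y p
    assume h: "smooth_map M h" and XY: "X \<in> vector_fields M" "Y \<in> vector_fields M" and p: "p \<in> M"
    note T = vector_fieldD(2)[OF XY(1) p] vector_fieldD(2)[OF XY(2) p]
    obtain L where "linear L" "\<And>v. v \<in> tangent_space M p \<Longrightarrow> differential M Y p v = L v"
      using differential_linear[OF vector_fieldD(1)[OF XY(2)] p] by metis
    then show "tconn (\<lambda>q. h q *\<^sub>R X q) Y p = h p *\<^sub>R tconn X Y p"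
      using T subspace_scale[OF subspace_tangent[OF p] T(1)] by (simp add: tconn_def linear_scale)
    show "tconn X (\<lambda>q. h q *\<^sub>R Y q) p
        = differential M h p (X p) *\<^sub>R Y p + h p *\<^sub>R tconn X Y p"
      using differential_scaleR[OF h vector_fieldD(1)[OF XY(2)] p T(1)]
      by (simp add: tconn_def tproj_ident[OF p T(2)])
  next
    fix X Y p
    assume XY: "X \<in> vector_fields M" "Y \<in> vector_fields M" and p: "p \<in> M"
    show "tconn X Y p - tconn Y X p = lie_bracket M X Y p"
      using tproj_ident[OF p lie_bracket_tangent[OF XY p]] by (simp add: tconn_def lie_bracket_def)
  next
    fix X Y Z p
    assume XY: "X \<in> vector_fields M" "Y \<in> vector_fields M" "Z \<in> vector_fields M" and p: "p \<in> M"
    note T = vector_fieldD(2)[OF XY(1) p] vector_fieldD(2)[OF XY(2) p] vector_fieldD(2)[OF XY(3) p]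
    show "differential M (\<lambda>q. Y q \<bullet> Z q) p (X p) = tconn X Y p \<bullet> Z p + Y p \<bullet> tconn X Z p"
      using differential_inner[OF vector_fieldD(1)[OF XY(2)] vector_fieldD(1)[OF XY(3)] p T(1)]
        tproj_inner[OF p T(3)] tproj_inner[OF p T(2)]
      by (simp add: tconn_def inner_commute)
  }
qed

lemma is_levi_civitaD:
  assumes "is_levi_civita M n" "X \<in> vector_fields M" "Y \<in> vector_fields M"
  shows "n X Y \<in> vector_fields M"
    and "p \<in> M \<Longrightarrow> n X Y p - n Y X p = lie_bracket M X Y p"
    and "Z \<in> vector_fields M \<Longrightarrow> p \<in> M \<Longrightarrow>
      differential M (\<lambda>q. Y q \<bullet> Z q) p (X p) = n X Y p \<bullet> Z p + Y p \<bullet> n X Z p"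
proof -
  have "\<forall>X\<in>vector_fields M. \<forall>Y\<in>vector_fields M. n X Y \<in> vector_fields M"
    using assms(1) unfolding is_levi_civita_def affine_connection_def by (elim conjE)
  from this[rule_format, OF assms(2,3)] show "n X Y \<in> vector_fields M" .
  have "\<forall>X\<in>vector_fields M. \<forall>Y\<in>vector_fields M. \<forall>p\<in>M.
      n X Y p - n Y X p = lie_bracket M X Y p"
    using assms(1) unfolding is_levi_civita_def by (elim conjE)
  from this[rule_format, OF assms(2,3)]
  show "p \<in> M \<Longrightarrow> n X Y p - n Y X p = lie_bracket M X Y p" .
  have "\<forall>X\<in>vector_fields M. \<forall>Y\<in>vector_fields M. \<forall>Z\<in>vector_fields M. \<forall>p\<in>M.
      differential M (\<lambda>q. Y q \<bullet> Z q) p (X p) = n X Y p \<bullet> Z p + Y p \<bullet> n X Z p"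
    using assms(1) unfolding is_levi_civita_def by (elim conjE)
  from this[rule_format, OF assms(2,3)]
  show "Z \<in> vector_fields M \<Longrightarrow> p \<in> M \<Longrightarrow>
      differential M (\<lambda>q. Y q \<bullet> Z q) p (X p) = n X Y p \<bullet> Z p + Y p \<bullet> n X Z p" .
qed

text \<open>
  The difference of two such connections is, after pairing with \<open>Z\<close>, symmetric in \<open>X, Y\<close> by vanishing
  torsion and skew in \<open>Y, Z\<close> by compatibility with the metric. A form that is symmetric in one pair of
  neighbours and skew in the other is zero. Choosing \<open>Z\<close> to extend the difference at \<open>p\<close> finishes the
  argument, without using that the difference is a tensor.
\<close>

lemma is_levi_civita_unique:
  assumes n: "is_levi_civita M n" and n': "is_levi_civita M n'"
    and XY: "X \<in> vector_fields M" "Y \<in> vector_fields M" and p: "p \<in> M"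
  shows "n X Y p = n' X Y p"
proof -
  define S where "S X Y Z = (n X Y p - n' X Y p) \<bullet> Z p" for X Y Z
  let ?V = "vector_fields M"
  have sym: "S X Y Z = S Y X Z" if "X \<in> ?V" "Y \<in> ?V" for X Y Z
  proof -
    have "n X Y p - n Y X p = n' X Y p - n' Y X p"
      using is_levi_civitaD(2)[OF n that p] is_levi_civitaD(2)[OF n' that p] by simp
    then have "n X Y p - n' X Y p = n Y X p - n' Y X p" by (simp add: algebra_simps)
    then show ?thesis by (simp add: S_def)
  qed
  have skew: "S X Y Z = - S X Z Y" if "X \<in> ?V" "Y \<in> ?V" "Z \<in> ?V" for X Y Z
  proof -
    have "n X Y p \<bullet> Z p + Y p \<bullet> n X Z p = n' X Y p \<bullet> Z p + Y p \<bullet> n' X Z p"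
      using is_levi_civitaD(3)[OF n that p] is_levi_civitaD(3)[OF n' that p] by simp
    then show ?thesis by (simp add: S_def inner_diff_left inner_diff_right inner_commute)
  qed
  have "n X Y p \<in> tangent_space M p" "n' X Y p \<in> tangent_space M p"
    using is_levi_civitaD(1)[OF n XY] is_levi_civitaD(1)[OF n' XY] vector_fieldD(2)[OF _ p] by auto
  then have "n X Y p - n' X Y p \<in> tangent_space M p"
    using subspace_diff[OF subspace_tangent[OF p]] by blast
  then obtain Z where Z: "Z \<in> ?V" "Z p = n X Y p - n' X Y p"
    using vector_field_extension[OF p] by metis
  have "S X Y Z = 0"
    using skew[OF XY(1,2) Z(1)] sym[OF XY(1) Z(1), of Y] skew[OF Z(1) XY] sym[OF Z(1) XY(2), of X]
      skew[OF XY(2) Z(1) XY(1)] sym[OF XY(2,1), of Z]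
    by linarith
  then show ?thesis using Z by (simp add: S_def)
qed

lemma levi_civita_eq_tconn:
  assumes "X \<in> vector_fields M" "Y \<in> vector_fields M"
  shows "p \<in> M \<Longrightarrow> levi_civita M X Y p = tconn X Y p" "levi_civita M X Y \<in> vector_fields M"
proof -
  have lc: "is_levi_civita M (levi_civita M)"
    unfolding levi_civita_def by (rule someI[of "is_levi_civita M", OF tconn_levi_civita])
  show "p \<in> M \<Longrightarrow> levi_civita M X Y p = tconn X Y p"
    using is_levi_civita_unique[OF lc tconn_levi_civita assms] .
  show "levi_civita M X Y \<in> vector_fields M"
    using is_levi_civitaD(1)[OF lc assms] .
qed

text \<open>
  Differentiating the extra terms of \<open>tconn_eq\<close> leaves, apart from multiples of the normal vectors
  \<open>p\<close> and \<open>\<xi> p\<close>, only the derivatives of \<open>q \<mapsto> q\<close> and of \<open>\<xi>\<close>. They are tangent and produce the two curvature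
  terms of the sphere and of the shape operator.
\<close>

lemma levi_civita_twice:
  assumes X: "X \<in> vector_fields M" and Y: "Y \<in> vector_fields M" and Z: "Z \<in> vector_fields M"
    and p: "p \<in> M"
  shows "levi_civita M X (levi_civita M Y Z) p
    = tproj p (differential M (\<lambda>q. differential M Z q (Y q)) p (X p))
      + (Y p \<bullet> Z p) *\<^sub>R X p + (shape p (Y p) \<bullet> Z p) *\<^sub>R shape p (X p)"
proof -
  note TX = vector_fieldD(2)[OF X p]
  note sm = vector_fieldD(1)[OF Y] vector_fieldD(1)[OF Z]
  let ?dd = "\<lambda>q. differential M Z q (Y q)"
  let ?a = "\<lambda>q. Y q \<bullet> Z q" and ?b = "\<lambda>q. differential M \<xi> q (Y q) \<bullet> Z q"
  have dd: "smooth_map M ?dd" by (rule smooth_map_differential[OF sm(2) Y])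
  have a: "smooth_map M ?a" by (intro smooth_map_inner sm)
  have b: "smooth_map M ?b" by (intro smooth_map_inner sm smooth_map_differential smooth_normal Y)
  note ap = smooth_map_scaleR[OF a smooth_map_ident]
  note b\<xi> = smooth_map_scaleR[OF b smooth_normal]
  have "differential M (levi_civita M Y Z) p (X p)
      = differential M (\<lambda>q. ?dd q + ?a q *\<^sub>R q + ?b q *\<^sub>R \<xi> q) p (X p)"
    by (rule differential_cong[OF _ _ p TX])
      (auto intro!: smooth_map_add dd ap b\<xi> simp: levi_civita_eq_tconn[OF Y Z] tconn_eq[OF Z Y] shape_def)
  also have "\<dots> = differential M ?dd p (X p)
      + (?a p *\<^sub>R X p + differential M ?a p (X p) *\<^sub>R p)
      + (?b p *\<^sub>R differential M \<xi> p (X p) + differential M ?b p (X p) *\<^sub>R \<xi> p)"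
    using differential_add[OF smooth_map_add[OF dd ap] b\<xi> p TX] differential_add[OF dd ap p TX]
      differential_scaleR[OF a smooth_map_ident p TX] differential_scaleR[OF b smooth_normal p TX]
      differential_ident[OF p TX]
    by simp
  finally have d: "differential M (levi_civita M Y Z) p (X p) = \<dots>" .
  have "levi_civita M X (levi_civita M Y Z) p = tproj p (differential M (levi_civita M Y Z) p (X p))"
    using levi_civita_eq_tconn(1)[OF X levi_civita_eq_tconn(2)[OF Y Z] p] by (simp add: tconn_def)
  then show ?thesis
    using tproj_ident[OF p differential_normal_tangent[OF p TX]] tproj_ident[OF p TX]
    by (simp add: d linear_add[OF linear_tproj] linear_scale[OF linear_tproj] tproj_normal[OF p] shape_def)
qed

lemma curvature_field_eq:
  assumes X: "X \<in> vector_fields M" and Y: "Y \<in> vector_fields M" and Z: "Z \<in> vector_fields M"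
    and p: "p \<in> M"
  shows "curvature_field M X Y Z p
    = (X p \<bullet> Z p) *\<^sub>R Y p - (Y p \<bullet> Z p) *\<^sub>R X p
      + (shape p (X p) \<bullet> Z p) *\<^sub>R shape p (Y p) - (shape p (Y p) \<bullet> Z p) *\<^sub>R shape p (X p)"
proof -
  have "levi_civita M (lie_bracket M X Y) Z p = tproj p (differential M Z p (lie_bracket M X Y p))"
    using levi_civita_eq_tconn(1)[OF lie_bracket_vector_field[OF X Y] Z p] by (simp add: tconn_def)
  also have "\<dots> = tproj p (differential M (\<lambda>q. differential M Z q (Y q)) p (X p))
      - tproj p (differential M (\<lambda>q. differential M Z q (X q)) p (Y p))"
    using differential_commutator[OF vector_fieldD(1)[OF Z] X Y p lie_bracket_tangent[OF X Y p]]
    by (simp flip: linear_diff[OF linear_tproj])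
  finally show ?thesis
    unfolding curvature_field_def levi_civita_twice[OF X Y Z p] levi_civita_twice[OF Y X Z p] by simp
qed

text \<open>
  The formula for fields depends on the values of the fields at \<open>p\<close> only, and every triple of tangent
  vectors is extended by some triple of fields; so the description of \<open>riemann\<close> is satisfied by exactly
  one vector.
\<close>

proposition gauss_equation:
  assumes p: "p \<in> M"
    and T: "u \<in> tangent_space M p" "v \<in> tangent_space M p" "w \<in> tangent_space M p"
  shows "riemann M p u v w = (u \<bullet> w) *\<^sub>R v - (v \<bullet> w) *\<^sub>R u
    + (shape p u \<bullet> w) *\<^sub>R shape p v - (shape p v \<bullet> w) *\<^sub>R shape p u"
  unfolding riemann_def
proof (rule the_equality)
  show "\<forall>X\<in>vector_fields M. \<forall>Y\<in>vector_fields M. \<forall>Z\<in>vector_fields M.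
      X p = u \<and> Y p = v \<and> Z p = w \<longrightarrow> curvature_field M X Y Z p = (u \<bullet> w) *\<^sub>R v - (v \<bullet> w) *\<^sub>R u
        + (shape p u \<bullet> w) *\<^sub>R shape p v - (shape p v \<bullet> w) *\<^sub>R shape p u"
    using curvature_field_eq p by blast
next
  fix r
  assume r: "\<forall>X\<in>vector_fields M. \<forall>Y\<in>vector_fields M. \<forall>Z\<in>vector_fields M.
      X p = u \<and> Y p = v \<and> Z p = w \<longrightarrow> curvature_field M X Y Z p = r"
  obtain X Y Z where "X \<in> vector_fields M" "X p = u" "Y \<in> vector_fields M" "Y p = v"
    "Z \<in> vector_fields M" "Z p = w"
    using vector_field_extension[OF p] T by metis
  then show "r = (u \<bullet> w) *\<^sub>R v - (v \<bullet> w) *\<^sub>R u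
      + (shape p u \<bullet> w) *\<^sub>R shape p v - (shape p v \<bullet> w) *\<^sub>R shape p u"
    using r curvature_field_eq p by blast
qed

end

section \<open>The *-Ricci curvature as a trace\<close>

text \<open>
  The trace of \<open>w \<mapsto> \<langle>a,w\<rangle>b\<close> is \<open>\<langle>a,b\<rangle>\<close> with respect to any basis, since the sum of the diagonal entries
  is \<open>a\<close> paired with the expansion of \<open>b\<close>. No independence of the basis has to be shown first.
\<close>

lemma trace_on_rank_one_sum:
  fixes V :: "'a::euclidean_space set"
  assumes V: "subspace V" and b: "\<And>i. i \<in> I \<Longrightarrow> b i \<in> V"
    and T: "\<And>w. w \<in> V \<Longrightarrow> T w = (\<Sum>i\<in>I. (a i \<bullet> w) *\<^sub>R b i)"
  shows "trace_on V T = (\<Sum>i\<in>I. a i \<bullet> b i)"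
proof -
  define B where "B = (SOME B. independent B \<and> span B = V)"
  have "\<exists>B. independent B \<and> span B = V"
    by (metis V basis_exists span_subspace)
  then have B: "independent B" "span B = V" unfolding B_def by (metis (mono_tags, lifting) someI_ex)+
  have BV: "x \<in> B \<Longrightarrow> x \<in> V" for x using B(2) span_superset by blast
  have "representation B (T x) x = (\<Sum>i\<in>I. (a i \<bullet> x) * representation B (b i) x)" if "x \<in> B" for x
    using representation_sum[OF B(1), of I "\<lambda>i. (a i \<bullet> x) *\<^sub>R b i"] b B(2)
    by (simp add: T BV that representation_scale[OF B(1)] subspace_scale[OF V])
  then have "trace_on V T = (\<Sum>x\<in>B. \<Sum>i\<in>I. (a i \<bullet> x) * representation B (b i) x)"
    unfolding trace_on_def B_def[symmetric] by (simp add: Let_def)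
  also have "\<dots> = (\<Sum>i\<in>I. a i \<bullet> (\<Sum>x\<in>B. representation B (b i) x *\<^sub>R x))"
    by (subst sum.swap) (simp add: inner_sum_right mult.commute)
  also have "\<dots> = (\<Sum>i\<in>I. a i \<bullet> b i)"
    using b B finiteI_independent[OF B(1)]
    by (intro sum.cong refl arg_cong2[where f = inner] sum_representation_eq) auto
  finally show ?thesis .
qed

context spherical_hypersurface
begin

text \<open>
  By the Gauss equation the trace is half of
  \<open>\<langle>u,v\<rangle> + \<langle>Jv,Ju\<rangle> - \<langle>Au,JAJv\<rangle> + \<langle>AJv,JAu\<rangle>\<close>. Since \<open>J\<close> is skew and \<open>A\<close> symmetric, each of the last two
  summands is \<open>-\<langle>u,AJAJv\<rangle>\<close>, which here is \<open>-\<langle>u,v\<rangle>\<close>.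
\<close>

proposition star_ricci_eq_0:
  assumes J: "almost_hermitian M J" and p: "p \<in> M"
    and uv: "u \<in> tangent_space M p" "v \<in> tangent_space M p"
    and AJAJ: "\<And>v. v \<in> tangent_space M p \<Longrightarrow> shape p (J p (shape p (J p v))) = v"
  shows "star_ricci M J p u v = 0"
proof -
  let ?T = "tangent_space M p" and ?A = "shape p" and ?J = "J p"
  have JT: "?J x \<in> ?T" and JJ: "?J (?J x) = - x" if "x \<in> ?T" for x
    using J p that unfolding almost_hermitian_def by blast+
  have Jlin: "?J (a *\<^sub>R x + b *\<^sub>R y) = a *\<^sub>R ?J x + b *\<^sub>R ?J y"
    and Jiso: "?J x \<bullet> ?J y = x \<bullet> y" if "x \<in> ?T" "y \<in> ?T" for x y a b
    using J p that unfolding almost_hermitian_def by blast+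
  have Jskew: "x \<bullet> ?J y = - (?J x \<bullet> y)" if "x \<in> ?T" "y \<in> ?T" for x y
    using Jiso[OF that(1) JT[OF that(2)]] JJ[OF that(2)] by simp
  note sub = subspace_tangent[OF p]
  note AT = shape_tangent[OF p]
  have lin4: "?J (a *\<^sub>R x - b *\<^sub>R y + c *\<^sub>R z - d *\<^sub>R w)
      = a *\<^sub>R ?J x - b *\<^sub>R ?J y + c *\<^sub>R ?J z - d *\<^sub>R ?J w"
    if "x \<in> ?T" "y \<in> ?T" "z \<in> ?T" "w \<in> ?T" for x y z w a b c d
  proof -
    have "a *\<^sub>R x + (-b) *\<^sub>R y \<in> ?T" "c *\<^sub>R z + (-d) *\<^sub>R w \<in> ?T"
      by (intro subspace_add[OF sub] subspace_scale[OF sub] that)+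
    then show ?thesis
      using Jlin[of "a *\<^sub>R x + (-b) *\<^sub>R y" "c *\<^sub>R z + (-d) *\<^sub>R w" 1 1]
        Jlin[OF that(1,2), of a "-b"] Jlin[OF that(3,4), of c "-d"]
      by (simp add: add_diff_eq)
  qed
  define v' where "v' = ?J v"
  have v': "v' \<in> ?T" unfolding v'_def by (rule JT[OF uv(2)])
  \<comment> \<open>The endomorphism is the sum of the four maps \<open>w \<mapsto> \<langle>a i, w\<rangle> b i\<close>.\<close>
  define a b where "a = (!) [u, v', ?A u, ?A v']"
    and "b = (!) [(- 1/2) *\<^sub>R ?J v', (1/2) *\<^sub>R ?J u, (- 1/2) *\<^sub>R ?J (?A v'), (1/2) *\<^sub>R ?J (?A u)]"
  have set4: "{..<4::nat} = {0, 1, 2, 3}" by auto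
  have "star_ricci M J p u v = (\<Sum>i<4. a i \<bullet> b i)"
    unfolding star_ricci_def v'_def[symmetric]
  proof (rule trace_on_rank_one_sum[OF sub])
    show "b i \<in> ?T" if "i \<in> {..<4}" for i
      using that uv v' unfolding set4 b_def
      by (auto intro!: subspace_neg[OF sub] subspace_scale[OF sub] JT AT)
    show "- (1/2) *\<^sub>R ?J (riemann M p u v' w) = (\<Sum>i<4. (a i \<bullet> w) *\<^sub>R b i)" if "w \<in> ?T" for w
      using uv v' that unfolding set4 a_def b_def gauss_equation[OF p uv(1) v' that]
      by (subst lin4) (auto intro: AT simp: algebra_simps)
  qed
  also have "\<dots> = (u \<bullet> v + v' \<bullet> ?J u - ?A u \<bullet> ?J (?A v') + ?A v' \<bullet> ?J (?A u)) / 2"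
    unfolding set4 a_def b_def using JJ[OF uv(2)] by (simp add: v'_def field_simps)
  also have "?A u \<bullet> ?J (?A v') = u \<bullet> v"
    using shape_self_adjoint[OF p uv(1) JT[OF AT[OF v']]] AJAJ[OF uv(2)] by (simp add: v'_def)
  also have "?A v' \<bullet> ?J (?A u) = - (u \<bullet> v)"
    using Jskew[OF AT[OF v'] AT[OF uv(1)]] \<open>?A u \<bullet> ?J (?A v') = u \<bullet> v\<close> by (simp add: inner_commute)
  also have "v' \<bullet> ?J u = u \<bullet> v"
    using Jiso[OF uv(2) uv(1)] by (simp add: v'_def inner_commute)
  finally show ?thesis by simp
qed

end

section \<open>Clifford systems\<close>

locale clifford =
  fixes m :: nat and P :: "nat \<Rightarrow> real^'n^'n"
  assumes clifford: "clifford_system m P"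
begin

text \<open>
  The linear combination \<open>\<Sum>\<^sub>i a\<^sub>i P\<^sub>i\<close>. Working with all combinations at once makes the computations
  independent of the choice of an orthonormal basis of the Clifford system.
\<close>

definition cl :: "(nat \<Rightarrow> real) \<Rightarrow> real^'n \<Rightarrow> real^'n" where
  "cl a x = (\<Sum>i\<le>m. a i *\<^sub>R (P i *v x))"

definition ip :: "(nat \<Rightarrow> real) \<Rightarrow> (nat \<Rightarrow> real) \<Rightarrow> real" where
  "ip a b = (\<Sum>i\<le>m. a i * b i)"

text \<open>
  The vectors \<open>P\<^sub>i x\<close> are orthogonal of length \<open>|x|\<close>, so for a unit vector \<open>x\<close> these are the
  coordinates of the projection of \<open>v\<close> to their span, and \<open>cl (coords x v) x\<close> is that projection. For
  \<open>v = x\<close> they are the quadratic forms in the OT--FKM polynomial.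
\<close>

definition coords :: "real^'n \<Rightarrow> real^'n \<Rightarrow> nat \<Rightarrow> real" where
  "coords x v i = (P i *v x) \<bullet> v"

lemma P_self_adjoint: "i \<le> m \<Longrightarrow> (P i *v x) \<bullet> y = x \<bullet> (P i *v y)"
  using clifford unfolding clifford_system_def
  by (metis dot_lmul_matrix transpose_matrix_vector)

lemma P_anticommute:
  assumes "i \<le> m" "j \<le> m"
  shows "P i *v (P j *v x) + P j *v (P i *v x) = (if i = j then 2 else 0) *\<^sub>R x"
proof -
  have "(P i ** P j + P j ** P i) *v x = ((if i = j then 2 else 0) *\<^sub>R mat 1) *v x"
    using clifford assms unfolding clifford_system_def by simp
  then show ?thesis
    by (simp add: matrix_vector_mult_add_rdistrib matrix_vector_mul_assoc scaleR_matrix_vector_assoc[symmetric]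
        split: if_splits)
qed

lemma linear_cl: "linear (cl a)"
  unfolding cl_def
  by (intro linear_compose_sum ballI linear_compose_scale_right matrix_vector_mul_linear)

lemmas cl_linear_simps =
  linear_add[OF linear_cl] linear_diff[OF linear_cl] linear_scale[OF linear_cl] linear_neg[OF linear_cl]

lemma cl_self_adjoint: "cl a x \<bullet> y = x \<bullet> cl a y"
  by (simp add: cl_def inner_sum_left inner_sum_right P_self_adjoint)

lemma cl_scaleR_left: "cl (\<lambda>i. r * a i) x = r *\<^sub>R cl a x"
  by (simp add: cl_def scaleR_sum_right)

lemma ip_scaleR_left: "ip (\<lambda>i. r * a i) b = r * ip a b"
  by (simp add: ip_def sum_distrib_left mult.assoc)

lemma ip_commute: "ip a b = ip b a"
  by (simp add: ip_def mult.commute)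

lemma ip_nonneg: "ip a a \<ge> 0"
  by (simp add: ip_def sum_nonneg)

lemma cl_anticommute: "cl a (cl b x) + cl b (cl a x) = (2 * ip a b) *\<^sub>R x"
proof -
  have exp: "cl a (cl b x) = (\<Sum>i\<le>m. \<Sum>j\<le>m. (a i * b j) *\<^sub>R (P i *v (P j *v x)))" for a b
    by (simp add: cl_def linear_sum[OF matrix_vector_mul_linear] matrix_vector_mult_scaleR scaleR_sum_right)
  have "cl a (cl b x) + cl b (cl a x)
      = (\<Sum>i\<le>m. \<Sum>j\<le>m. (a i * b j) *\<^sub>R (P i *v (P j *v x) + P j *v (P i *v x)))"
    unfolding exp[of a b] exp[of b a]
    by (subst (2) sum.swap) (simp add: sum.distrib[symmetric] scaleR_add_right mult.commute)
  also have "\<dots> = (\<Sum>i\<le>m. \<Sum>j\<le>m. if i = j then (2 * (a i * b j)) *\<^sub>R x else 0)"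
    by (intro sum.cong refl) (simp add: P_anticommute)
  also have "\<dots> = (2 * ip a b) *\<^sub>R x"
    by (simp add: ip_def sum_distrib_left scaleR_sum_left)
  finally show ?thesis .
qed

lemma cl_square: "cl a (cl a x) = ip a a *\<^sub>R x"
  using cl_anticommute[of a a x] by (simp add: scaleR_2[symmetric] flip: scaleR_scaleR)

lemma cl_inner_cl: "cl a x \<bullet> cl b x = ip a b * (x \<bullet> x)"
proof -
  have "cl a x \<bullet> cl b x = x \<bullet> cl a (cl b x)" "cl a x \<bullet> cl b x = x \<bullet> cl b (cl a x)"
    using cl_self_adjoint[of a x "cl b x"] cl_self_adjoint[of b x "cl a x"]
    by (simp_all add: inner_commute[of "cl b x"])
  then have "2 * (cl a x \<bullet> cl b x) = x \<bullet> (cl a (cl b x) + cl b (cl a x))"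
    by (simp add: inner_add_right)
  then show ?thesis by (simp add: cl_anticommute)
qed

lemma cl_inner_coords: "cl a x \<bullet> v = ip a (coords x v)"
  by (simp add: cl_def ip_def coords_def inner_sum_left)

text \<open>
  A polarised form of \<open>a n a = 2\<langle>a,n\<rangle>a - |a|\<^sup>2 n\<close> for Clifford elements. Reversing the order of the three factors does not
  change \<open>\<langle>cl b x, cl n (cl a x)\<rangle>\<close>, so only the symmetrised product matters, and that one is reduced by
  the anticommutation relations to a combination of single Clifford elements.
\<close>

lemma cl_triple:
  "cl b x \<bullet> cl n (cl a x)
    = ip b n * ip a (coords x x) - ip a b * ip n (coords x x) + ip a n * ip b (coords x x)"
proof -
  have ac: "cl a (cl b y) = (2 * ip a b) *\<^sub>R y - cl b (cl a y)" for a b y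
    using cl_anticommute[of a b y] by (simp add: algebra_simps)
  have 1: "cl b x \<bullet> cl n (cl a x) = x \<bullet> cl b (cl n (cl a x))" by (rule cl_self_adjoint)
  have 2: "cl b x \<bullet> cl n (cl a x) = x \<bullet> cl a (cl n (cl b x))"
    using cl_self_adjoint[of n "cl b x" "cl a x"] cl_self_adjoint[of a x "cl n (cl b x)"]
    by (simp add: inner_commute[of "cl n (cl b x)"])
  have "cl b (cl n (cl a x)) + cl a (cl n (cl b x))
      = (2 * ip b n) *\<^sub>R cl a x - cl n (cl b (cl a x) + cl a (cl b x)) + (2 * ip a n) *\<^sub>R cl b x"
    by (simp add: ac[of b n] ac[of a n] cl_linear_simps)
  also have "\<dots> = (2 * ip b n) *\<^sub>R cl a x - (2 * ip a b) *\<^sub>R cl n x + (2 * ip a n) *\<^sub>R cl b x"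
    by (simp add: cl_anticommute cl_linear_simps ip_commute[of b a])
  finally have sum: "cl b (cl n (cl a x)) + cl a (cl n (cl b x)) = \<dots>" .
  have "2 * (cl b x \<bullet> cl n (cl a x)) = x \<bullet> (cl b (cl n (cl a x)) + cl a (cl n (cl b x)))"
    using 1 2 by (simp add: inner_add_right)
  then have "2 * (cl b x \<bullet> cl n (cl a x))
      = x \<bullet> ((2 * ip b n) *\<^sub>R cl a x - (2 * ip a b) *\<^sub>R cl n x + (2 * ip a n) *\<^sub>R cl b x)"
    unfolding sum .
  then show ?thesis
    by (simp add: inner_add_right inner_diff_right cl_inner_coords[of _ x x] inner_commute[of x])
qed

lemma coords_cl:
  assumes "i \<le> m"
  shows "coords x (cl a y) i = cl (\<lambda>j. of_bool (j = i)) x \<bullet> cl a y"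
  using assms by (simp add: coords_def cl_def of_bool_def if_distrib[of "\<lambda>r. r *\<^sub>R _"] cong: if_cong)

lemma ip_unit: "i \<le> m \<Longrightarrow> ip (\<lambda>j. of_bool (j = i)) a = a i"
  by (simp add: ip_def of_bool_def if_distrib[of "\<lambda>r. r * _"] cong: if_cong)

lemma cl_cong: "(\<And>i. i \<le> m \<Longrightarrow> a i = b i) \<Longrightarrow> cl a x = cl b x"
  by (simp add: cl_def)

lemma fkm_poly_eq: "fkm_poly m P x = (x \<bullet> x)\<^sup>2 - 2 * ip (coords x x) (coords x x)"
  by (simp add: fkm_poly_def ip_def coords_def power2_norm_eq_inner[symmetric] power2_eq_square[symmetric]
      flip: power_mult)

lemma has_derivative_coords:
  "((\<lambda>x. coords x x i) has_derivative (\<lambda>v. 2 * coords x v i)) (at x)" if "i \<le> m"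
proof -
  have "((\<lambda>x. (P i *v x) \<bullet> x) has_derivative (\<lambda>v. (P i *v x) \<bullet> v + (P i *v v) \<bullet> x)) (at x)"
    by (intro has_derivative_inner has_derivative_ident
        linear_imp_has_derivative[OF matrix_vector_mul_linear])
  then show ?thesis
    using P_self_adjoint[OF that] by (simp add: coords_def inner_commute)
qed

lemma has_derivative_ip_coords:
  "((\<lambda>x. ip (coords x x) (coords x x)) has_derivative
    (\<lambda>v. 4 * (cl (coords x x) x \<bullet> v))) (at x)"
proof -
  have "((\<lambda>x. \<Sum>i\<le>m. coords x x i * coords x x i) has_derivative
    (\<lambda>v. \<Sum>i\<le>m. coords x x i * (2 * coords x v i) + 2 * coords x v i * coords x x i)) (at x)"
    by (intro has_derivative_sum has_derivative_mult has_derivative_coords) auto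
  moreover have "(\<Sum>i\<le>m. coords x x i * (2 * coords x v i) + 2 * coords x v i * coords x x i)
      = 4 * (cl (coords x x) x \<bullet> v)" for v
    unfolding cl_inner_coords ip_def sum_distrib_left by (intro sum.cong) auto
  ultimately show ?thesis by (simp add: ip_def)
qed

lemma has_derivative_cl_coords:
  "((\<lambda>x. cl (coords x x) x) has_derivative
    (\<lambda>v. cl (coords x x) v + 2 *\<^sub>R cl (coords x v) x)) (at x)"
proof -
  have "((\<lambda>x. \<Sum>i\<le>m. coords x x i *\<^sub>R (P i *v x)) has_derivative
    (\<lambda>v. \<Sum>i\<le>m. coords x x i *\<^sub>R (P i *v v) + (2 * coords x v i) *\<^sub>R (P i *v x))) (at x)"
    by (intro has_derivative_sum has_derivative_scaleR has_derivative_coords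
        linear_imp_has_derivative matrix_vector_mul_linear) auto
  then show ?thesis
    by (simp add: cl_def sum.distrib scaleR_sum_right)
qed

lemma smooth_on_cl_coords: "smooth_on UNIV (\<lambda>x. cl (coords x x) x)"
  unfolding cl_def coords_def
  by (intro smooth_on_sum smooth_on_scaleR smooth_on_inner open_UNIV smooth_on_linear
      matrix_vector_mul_linear linear_id[unfolded id_def])

text \<open>
  There are at least two coordinates, so the rotation \<open>(n\<^sub>1, -n\<^sub>0)\<close> of the first two is orthogonal to
  \<open>n\<close>; if it vanishes, a unit vector does.
\<close>

lemma exists_orthogonal_coords:
  assumes "m \<ge> 1"
  shows "\<exists>a. ip a a \<noteq> 0 \<and> ip a n = 0"
proof -
  have two: "ip a b = a 0 * b 0 + a 1 * b 1" if "\<And>i. i > 1 \<Longrightarrow> a i = 0" for a b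
  proof -
    have "ip a b = (\<Sum>i\<in>{0, 1}. a i * b i)"
      unfolding ip_def using assms that by (intro sum.mono_neutral_right) auto
    then show ?thesis by simp
  qed
  show ?thesis
  proof (cases "n 0 = 0 \<and> n 1 = 0")
    case True
    then show ?thesis
      by (intro exI[of _ "\<lambda>i. of_bool (i = 0)"]) (simp add: two)
  next
    case False
    then have "n 1 * n 1 + n 0 * n 0 \<noteq> 0" by auto
    then show ?thesis
      by (intro exI[of _ "\<lambda>i. if i = 0 then n 1 else if i = 1 then - n 0 else 0"]) (simp add: two)
  qed
qed

text \<open>
  An element \<open>cl a\<close> that anticommutes with the involution \<open>cl n\<close> exchanges its two eigenspaces, so each
  of them has half the dimension.
\<close>

lemma dim_cl_fixed:
  assumes m: "m \<ge> 1" and n: "ip n n = 1"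
  shows "CARD('n) \<le> 2 * dim {v. cl n v = v}"
proof -
  let ?V = "{v. cl n v = v}" and ?W = "{v. cl n v = - v}"
  have sub: "subspace ?V" "subspace ?W"
    by (auto simp: subspace_def cl_linear_simps linear_0[OF linear_cl])
  obtain a where a: "ip a a \<noteq> 0" "ip a n = 0" using exists_orthogonal_coords[OF m] by blast
  have "inj (cl a)"
  proof (rule inj_on_inverseI[of _ "\<lambda>y. (1 / ip a a) *\<^sub>R cl a y"])
    show "(1 / ip a a) *\<^sub>R cl a (cl a v) = v" for v using a(1) by (simp add: cl_square)
  qed
  moreover have "cl a ` ?W \<subseteq> ?V"
  proof safe
    fix v assume "cl n v = - v"
    then show "cl n (cl a v) = cl a v"
      using cl_anticommute[of a n v] a(2) by (simp add: cl_linear_simps add_eq_0_iff)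
  qed
  ultimately have le: "dim ?W \<le> dim ?V"
    using dim_image_eq[OF linear_cl[of a] inj_on_subset[OF _ subset_UNIV, of "cl a" "span ?W"]]
      dim_subset[of "cl a ` ?W" ?V]
    by simp
  have "v \<in> {x + y |x y. x \<in> ?V \<and> y \<in> ?W}" for v
  proof -
    have "v = (1/2) *\<^sub>R (v + cl n v) + (1/2) *\<^sub>R (v - cl n v)"
      by (simp add: algebra_simps flip: scaleR_add_left)
    moreover have "(1/2) *\<^sub>R (v + cl n v) \<in> ?V" "(1/2) *\<^sub>R (v - cl n v) \<in> ?W"
      by (simp_all add: cl_linear_simps cl_square n algebra_simps)
    ultimately show ?thesis by blast
  qed
  then have "{x + y |x y. x \<in> ?V \<and> y \<in> ?W} = UNIV" by blast
  then have "CARD('n) \<le> dim ?V + dim ?W"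
    using dim_sums_Int[OF sub] by (simp add: dim_UNIV)
  with le show ?thesis by simp
qed

end

section \<open>Tangent spaces and unit normal of the OT--FKM hypersurfaces\<close>

text \<open>
  For the inclusion that needs curves, normalise the line \<open>x + t v\<close>.
\<close>

lemma tangent_space_sphere:
  fixes x :: "'a::euclidean_space"
  assumes "x \<in> sphere 0 1"
  shows "tangent_space (sphere 0 1) x = {v. x \<bullet> v = 0}"
proof (intro set_eqI iffI; unfold mem_Collect_eq)
  have x1: "x \<bullet> x = 1" using assms by (simp add: norm_eq_1)
  fix v
  {
    assume v: "v \<in> tangent_space (sphere 0 1) x"
    have "((\<lambda>x::'a. x \<bullet> x) has_derivative (\<lambda>v. x \<bullet> v + v \<bullet> x)) (at x)"
      by (intro has_derivative_inner has_derivative_ident)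
    from differential_eq[OF this open_UNIV UNIV_I assms refl v]
      differential_const_on[of "sphere 0 1" "\<lambda>x. x \<bullet> x" 1, OF _ assms v]
    show "x \<bullet> v = 0" by (simp add: norm_eq_1 inner_commute)
  }
  {
    assume v: "x \<bullet> v = 0"
    define \<gamma> where "\<gamma> t = (1 / sqrt (1 + t\<^sup>2 * (v \<bullet> v))) *\<^sub>R (x + t *\<^sub>R v)" for t
    have pos: "1 + t\<^sup>2 * (v \<bullet> v) > 0" for t by (intro add_pos_nonneg) auto
    have "\<gamma> t \<bullet> \<gamma> t = 1" for t
    proof -
      have "(x + t *\<^sub>R v) \<bullet> (x + t *\<^sub>R v) = 1 + t\<^sup>2 * (v \<bullet> v)"
        using v by (simp add: inner_add_left inner_add_right x1 inner_commute power2_eq_square)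
      then show ?thesis using pos[of t] by (simp add: \<gamma>_def)
    qed
    then have "\<gamma> t \<in> sphere 0 1" for t by (simp add: norm_eq_1)
    moreover have "(\<gamma> has_vector_derivative v) (at 0)"
      unfolding \<gamma>_def by (auto intro!: derivative_eq_intros)
    moreover have "\<gamma> 0 = x" by (simp add: \<gamma>_def)
    ultimately show "v \<in> tangent_space (sphere 0 1) x"
      unfolding tangent_space_def by (intro CollectI exI[of _ \<gamma>] exI[of _ 1]) simp
  }
qed

locale fkm = clifford m P for m :: nat and P :: "nat \<Rightarrow> real^'n^'n" +
  fixes \<theta> :: real
  assumes theta: "0 < \<theta>" "\<theta> < pi / 4"
begin

definition s :: real where "s = sin (2 * \<theta>)"
definition c :: real where "c = cos (2 * \<theta>)"

abbreviation M :: "(real^'n) set" where "M \<equiv> fkm_hypersurface m P \<theta>"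

definition normal :: "real^'n \<Rightarrow> real^'n" where
  "normal x = (1 / (s * c)) *\<^sub>R (s\<^sup>2 *\<^sub>R x - cl (coords x x) x)"

text \<open>
  The negative derivative of \<open>normal\<close>, as a linear map on the whole ambient space; on tangent vectors
  it is the shape operator.
\<close>

definition weingarten :: "real^'n \<Rightarrow> real^'n \<Rightarrow> real^'n" where
  "weingarten x v = (1 / (s * c)) *\<^sub>R (cl (coords x x) v + 2 *\<^sub>R cl (coords x v) x - s\<^sup>2 *\<^sub>R v)"

lemma s_c: "0 < s" "0 < c" "s\<^sup>2 + c\<^sup>2 = 1" "s < 1" "c\<^sup>2 = 1 - s\<^sup>2"
proof -
  show "0 < s" "0 < c"
    unfolding s_def c_def using theta by (auto intro!: sin_gt_zero cos_gt_zero)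
  show sq: "s\<^sup>2 + c\<^sup>2 = 1" by (simp add: s_def c_def)
  then show c2: "c\<^sup>2 = 1 - s\<^sup>2" by simp
  have "s\<^sup>2 < 1\<^sup>2" using c2 \<open>0 < c\<close> zero_less_power[of c 2] by simp
  then show "s < 1" using power2_less_imp_less[of s 1] by simp
qed

lemma M_iff: "x \<in> M \<longleftrightarrow> x \<bullet> x = 1 \<and> ip (coords x x) (coords x x) = s\<^sup>2"
proof -
  have "cos (4 * \<theta>) = 1 - 2 * s\<^sup>2"
    unfolding s_def using cos_double_sin[of "2 * \<theta>"] by simp
  then show ?thesis
    by (auto simp: fkm_hypersurface_def fkm_poly_eq norm_eq_1)
qed

text \<open>
  Let \<open>N\<close> be the Clifford element with coordinates \<open>coords y y\<close> divided by \<open>r\<close>, and \<open>y\<^sub>+\<close>, \<open>y\<^sub>-\<close> the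
  components of \<open>y\<close> in its eigenspaces for \<open>1\<close> and \<open>-1\<close>. The vector in question is \<open>\<alpha> y\<^sub>+ + \<beta> y\<^sub>-\<close>. Clifford
  elements orthogonal to \<open>N\<close> exchange the eigenspaces, so their quadratic forms stay zero; hence the
  coordinates keep their direction, and \<open>\<alpha>\<close>, \<open>\<beta>\<close> are such that the norm becomes \<open>1\<close> and their length \<open>s\<close>.
\<close>

lemma retraction_in_M:
  assumes r: "0 < r" "r < y \<bullet> y" "r\<^sup>2 = ip (coords y y) (coords y y)"
    and \<alpha>: "\<alpha>\<^sup>2 = (1 + s) / (y \<bullet> y + r)" and \<beta>: "\<beta>\<^sup>2 = (1 - s) / (y \<bullet> y - r)"
  shows "((\<alpha> + \<beta>) / 2) *\<^sub>R y + ((\<alpha> - \<beta>) / (2 * r)) *\<^sub>R cl (coords y y) y \<in> M"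
proof -
  let ?Y = "y \<bullet> y" and ?q = "coords y y"
  define a b where "a = (\<alpha> + \<beta>) / 2" and "b = (\<alpha> - \<beta>) / (2 * r)"
  define z where "z = a *\<^sub>R y + b *\<^sub>R cl ?q y"
  have \<alpha>\<beta>: "\<alpha>\<^sup>2 * (?Y + r) = 1 + s" "\<beta>\<^sup>2 * (?Y - r) = 1 - s"
    using r \<alpha> \<beta> by (auto simp: field_simps)
  have br: "b * r = (\<alpha> - \<beta>) / 2" using r by (simp add: b_def)
  have yq: "y \<bullet> cl ?q y = r\<^sup>2" "cl ?q y \<bullet> y = r\<^sup>2" "cl ?q y \<bullet> cl ?q y = r\<^sup>2 * ?Y"
    using r(3) cl_inner_coords[of ?q y y] by (simp_all add: inner_commute cl_inner_cl)
  have "z \<bullet> z = a\<^sup>2 * ?Y + 2 * a * (b * r) * r + (b * r)\<^sup>2 * ?Y"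
    unfolding z_def inner_add_left inner_add_right inner_scaleR_left inner_scaleR_right yq
    by (simp add: power2_eq_square algebra_simps)
  also have "\<dots> = (\<alpha>\<^sup>2 * (?Y + r) + \<beta>\<^sup>2 * (?Y - r)) / 2"
    unfolding br a_def by (simp add: power2_eq_square field_simps)
  finally have zz: "z \<bullet> z = 1" unfolding \<alpha>\<beta> by simp
  have q: "coords z z i = (s / r) * ?q i" if i: "i \<le> m" for i
  proof -
    let ?d = "\<lambda>j. of_bool (j = i) :: real"
    have ci: "coords z z i = cl ?d z \<bullet> z"
      using ip_unit[OF i] by (simp add: cl_inner_coords)
    have di: "ip ?d ?q = ?q i" "ip ?q ?d = ?q i"
      using ip_unit[OF i] ip_commute[of ?q] by simp_all
    have dy: "cl ?d y \<bullet> y = ?q i" by (simp add: cl_inner_coords di)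
    have t: "cl ?d (cl ?q y) \<bullet> y = ?q i * ?Y" "cl ?d y \<bullet> cl ?q y = ?q i * ?Y"
      using cl_self_adjoint[of ?d "cl ?q y" y] by (simp_all add: cl_inner_cl di inner_commute[of "cl ?q y"])
    have "cl ?d (cl ?q y) \<bullet> cl ?q y = cl ?q y \<bullet> cl ?d (cl ?q y)" by (rule inner_commute)
    also have "\<dots> = r\<^sup>2 * ?q i"
      unfolding cl_triple by (simp add: di r(3))
    finally have t2: "cl ?d (cl ?q y) \<bullet> cl ?q y = r\<^sup>2 * ?q i" .
    have "coords z z i = (a\<^sup>2 * r + 2 * a * (b * r) * ?Y + (b * r)\<^sup>2 * r) / r * ?q i"
      unfolding ci unfolding z_def cl_linear_simps inner_add_left inner_add_right inner_scaleR_left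
        inner_scaleR_right t t2 dy
      using r(1) by (simp add: power2_eq_square field_simps)
    also have "a\<^sup>2 * r + 2 * a * (b * r) * ?Y + (b * r)\<^sup>2 * r
        = (\<alpha>\<^sup>2 * (?Y + r) - \<beta>\<^sup>2 * (?Y - r)) / 2"
      unfolding br a_def by (simp add: power2_eq_square field_simps)
    finally show ?thesis unfolding \<alpha>\<beta> by simp
  qed
  have "ip (coords z z) (coords z z) = ip (\<lambda>i. (s / r) * ?q i) (\<lambda>i. (s / r) * ?q i)"
    unfolding ip_def by (intro sum.cong) (auto simp: q)
  also have "\<dots> = (s / r)\<^sup>2 * ip ?q ?q"
    using ip_scaleR_left[of "s / r" ?q] ip_commute by (simp add: power2_eq_square ip_commute)
  also have "\<dots> = s\<^sup>2" using r by (simp flip: r(3) add: power_divide)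
  finally show ?thesis using zz unfolding M_iff z_def a_def b_def by blast
qed

text \<open>
  The line \<open>x + t v\<close> is moved onto the hypersurface by the retraction of \<open>retraction_in_M\<close>. As \<open>v\<close> is
  orthogonal to the gradients of the defining functions, these are constant to first order along the
  line; so the factors \<open>\<alpha>\<close>, \<open>\<beta>\<close> equal \<open>1\<close> up to second order, and the velocity is still \<open>v\<close>.
\<close>

lemma tangent_space_M:
  assumes x: "x \<in> M"
  shows "tangent_space M x = {v. x \<bullet> v = 0 \<and> cl (coords x x) x \<bullet> v = 0}"
proof (intro set_eqI iffI; unfold mem_Collect_eq)
  fix v
  {
    assume v: "v \<in> tangent_space M x"
    have "((\<lambda>x::real^'n. x \<bullet> x) has_derivative (\<lambda>v. x \<bullet> v + v \<bullet> x)) (at x)"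
      by (intro has_derivative_inner has_derivative_ident)
    from differential_eq[OF this open_UNIV UNIV_I x refl v]
      differential_const_on[of M "\<lambda>x. x \<bullet> x" 1, OF _ x v]
    have 1: "x \<bullet> v = 0" by (simp add: M_iff inner_commute)
    from differential_eq[OF has_derivative_ip_coords open_UNIV UNIV_I x refl v]
      differential_const_on[of M "\<lambda>x. ip (coords x x) (coords x x)" "s\<^sup>2", OF _ x v]
    have "cl (coords x x) x \<bullet> v = 0" by (simp add: M_iff)
    with 1 show "x \<bullet> v = 0 \<and> cl (coords x x) x \<bullet> v = 0" by simp
  }
  {
    assume v: "x \<bullet> v = 0 \<and> cl (coords x x) x \<bullet> v = 0"
    define y where "y t = x + t *\<^sub>R v" for t
    define Y where "Y t = y t \<bullet> y t" for t
    define R where "R t = ip (coords (y t) (y t)) (coords (y t) (y t))" for t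
    define r where "r t = sqrt (R t)" for t
    define \<alpha> where "\<alpha> t = sqrt ((1 + s) / (Y t + r t))" for t
    define \<beta> where "\<beta> t = sqrt ((1 - s) / (Y t - r t))" for t
    define \<gamma> where "\<gamma> t = ((\<alpha> t + \<beta> t) / 2) *\<^sub>R y t
      + ((\<alpha> t - \<beta> t) / (2 * r t)) *\<^sub>R cl (coords (y t) (y t)) (y t)" for t
    have at0: "y 0 = x" "Y 0 = 1" "R 0 = s\<^sup>2" "r 0 = s"
      using x s_c(1) by (simp_all add: y_def Y_def R_def r_def M_iff)
    have at0': "\<alpha> 0 = 1" "\<beta> 0 = 1"
      unfolding \<alpha>_def \<beta>_def at0 using s_c by simp_all
    have dy: "(y has_derivative (\<lambda>t. t *\<^sub>R v)) (at 0)"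
      unfolding y_def by (auto intro!: derivative_eq_intros)
    have "((\<lambda>t. y t \<bullet> y t) has_derivative (\<lambda>t. y 0 \<bullet> t *\<^sub>R v + t *\<^sub>R v \<bullet> y 0)) (at 0)"
      by (intro has_derivative_inner dy)
    then have dY: "(Y has_real_derivative 0) (at 0)"
      using v by (simp add: Y_def[abs_def] at0 has_field_derivative_def inner_commute lambda_zero)
    have "(R has_derivative (\<lambda>t. 4 * (cl (coords (y 0) (y 0)) (y 0) \<bullet> t *\<^sub>R v))) (at 0)"
      unfolding R_def by (rule has_derivative_compose[OF dy has_derivative_ip_coords])
    then have dR: "(R has_real_derivative 0) (at 0)"
      using v by (simp add: at0 has_field_derivative_def lambda_zero)
    have dr: "(r has_real_derivative 0) (at 0)"
      unfolding r_def using s_c(1) by (auto intro!: derivative_eq_intros dR simp: at0)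
    have d\<alpha>: "(\<alpha> has_real_derivative 0) (at 0)"
      unfolding \<alpha>_def using s_c by (auto intro!: derivative_eq_intros dY dr simp: at0)
    have d\<beta>: "(\<beta> has_real_derivative 0) (at 0)"
      unfolding \<beta>_def using s_c by (auto intro!: derivative_eq_intros dY dr simp: at0)
    have dcoef: "((\<lambda>t. (\<alpha> t + \<beta> t) / 2) has_derivative (\<lambda>t. 0)) (at 0)"
      "((\<lambda>t. (\<alpha> t - \<beta> t) / (2 * r t)) has_derivative (\<lambda>t. 0)) (at 0)"
      using s_c(1) by (auto intro!: derivative_eq_intros d\<alpha> d\<beta> dr
          simp: at0 at0' lambda_zero has_field_derivative_def[symmetric, of _ 0, simplified lambda_zero])
    obtain k where dcl: "((\<lambda>t. cl (coords (y t) (y t)) (y t)) has_derivative k) (at 0)"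
      using has_derivative_compose[OF dy has_derivative_cl_coords] by blast
    have "(\<gamma> has_derivative (\<lambda>t. (((\<alpha> 0 + \<beta> 0) / 2) *\<^sub>R (t *\<^sub>R v) + 0 *\<^sub>R y 0)
        + (((\<alpha> 0 - \<beta> 0) / (2 * r 0)) *\<^sub>R k t + 0 *\<^sub>R cl (coords (y 0) (y 0)) (y 0)))) (at 0)"
      unfolding \<gamma>_def by (intro has_derivative_add has_derivative_scaleR dcoef dy dcl)
    then have d\<gamma>: "(\<gamma> has_vector_derivative v) (at 0)"
      by (simp add: at0' has_vector_derivative_def)
    have \<gamma>0: "\<gamma> 0 = x" by (simp add: \<gamma>_def at0 at0')
    have pos_near: "eventually (\<lambda>t. 0 < g t) (nhds 0)"
      if "isCont g 0" "0 < g 0" for g :: "real \<Rightarrow> real"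
      using order_tendstoD(1)[OF that(1)[unfolded isCont_def tendsto_at_iff_tendsto_nhds] that(2)] .
    have "eventually (\<lambda>t. 0 < r t) (nhds 0)" "eventually (\<lambda>t. 0 < Y t - r t) (nhds 0)"
      using DERIV_isCont[OF dr] DERIV_isCont[OF DERIV_diff[OF dY dr]] s_c
      by (auto intro!: pos_near simp: at0 simp del: diff_gt_0_iff_gt)
    then have "eventually (\<lambda>t. 0 < r t \<and> 0 < Y t - r t) (nhds 0)" by (rule eventually_conj)
    then obtain e where e: "e > 0" "\<And>t. \<bar>t\<bar> < e \<Longrightarrow> 0 < r t \<and> 0 < Y t - r t"
      unfolding eventually_nhds_metric by (auto simp: dist_real_def)
    have "\<gamma> t \<in> M" if "\<bar>t\<bar> < e" for t
      unfolding \<gamma>_def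
    proof (rule retraction_in_M)
      note pos = e(2)[OF that]
      show "0 < r t" "r t < y t \<bullet> y t" using pos by (auto simp: Y_def)
      show "(r t)\<^sup>2 = ip (coords (y t) (y t)) (coords (y t) (y t))"
        by (simp add: r_def R_def ip_nonneg)
      show "(\<alpha> t)\<^sup>2 = (1 + s) / (y t \<bullet> y t + r t)" "(\<beta> t)\<^sup>2 = (1 - s) / (y t \<bullet> y t - r t)"
        using pos s_c by (auto simp: \<alpha>_def \<beta>_def Y_def)
    qed
    then show "v \<in> tangent_space M x"
      unfolding tangent_space_def using e(1) \<gamma>0 d\<gamma>
      by (intro CollectI exI[of _ \<gamma>] exI[of _ e]) simp
  }
qed

lemma smooth_on_normal: "smooth_on UNIV normal"
proof -
  have "smooth_on UNIV (\<lambda>x. (1 / (s * c)) *\<^sub>R (s\<^sup>2 *\<^sub>R x + (- 1) *\<^sub>R cl (coords x x) x))"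
    by (intro smooth_on_scaleR smooth_on_add smooth_on_const smooth_on_cl_coords open_UNIV
        smooth_on_linear linear_id[unfolded id_def])
  then show ?thesis by (simp add: normal_def[abs_def])
qed

lemma has_derivative_normal: "(normal has_derivative (\<lambda>v. - weingarten x v)) (at x)"
proof -
  have "(normal has_derivative (\<lambda>v. (1 / (s * c)) *\<^sub>R
      (s\<^sup>2 *\<^sub>R v - (cl (coords x x) v + 2 *\<^sub>R cl (coords x v) x)))) (at x)"
    unfolding normal_def[abs_def]
    by (intro has_derivative_scaleR_right has_derivative_diff has_derivative_ident has_derivative_cl_coords)
  moreover have "(1 / (s * c)) *\<^sub>R (s\<^sup>2 *\<^sub>R v - (cl (coords x x) v + 2 *\<^sub>R cl (coords x v) x))
      = - weingarten x v" for v
    unfolding weingarten_def scaleR_minus_right[symmetric] by simp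
  ultimately show ?thesis by simp
qed

lemma weingarten_self_adjoint: "weingarten x u \<bullet> v = u \<bullet> weingarten x v"
proof -
  have "cl (coords x u) x \<bullet> v = u \<bullet> cl (coords x v) x"
    using cl_inner_coords ip_commute inner_commute by metis
  then show ?thesis
    by (simp add: weingarten_def inner_add_left inner_add_right inner_diff_left inner_diff_right cl_self_adjoint)
qed

lemma linear_weingarten: "linear (weingarten x)"
  using has_derivative_linear[OF has_derivative_normal, of x] linear_compose_neg[of "\<lambda>v. - weingarten x v"]
  by simp

sublocale spherical_hypersurface M normal
proof
  show "smooth_map M normal" by (rule smooth_on_imp_smooth_map[OF smooth_on_normal])
  fix x assume x: "x \<in> M"
  have x': "x \<bullet> x = 1" "ip (coords x x) (coords x x) = s\<^sup>2" using x by (auto simp: M_iff)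
  have xq: "x \<bullet> cl (coords x x) x = s\<^sup>2" "cl (coords x x) x \<bullet> x = s\<^sup>2" "cl (coords x x) x \<bullet> cl (coords x x) x = s\<^sup>2"
    using x' cl_inner_coords[of "coords x x" x x] by (simp_all add: inner_commute cl_inner_cl)
  show "x \<bullet> x = 1" by (rule x')
  show "x \<bullet> normal x = 0" by (simp add: normal_def inner_diff_right x' xq)
  have "normal x \<bullet> normal x = (1 / (s * c))\<^sup>2 * (s\<^sup>2 * (1 - s\<^sup>2))"
    by (simp add: normal_def inner_diff_right inner_diff_left x' xq power2_eq_square algebra_simps)
  also have "\<dots> = 1"
    unfolding s_c(5)[symmetric] using s_c(1,2) by (simp add: power_divide power_mult_distrib)
  finally show "normal x \<bullet> normal x = 1" .
  fix v
  show "v \<in> tangent_space M x \<longleftrightarrow> x \<bullet> v = 0 \<and> normal x \<bullet> v = 0"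
    unfolding tangent_space_M[OF x] using s_c(1,2)
    by (auto simp: normal_def inner_diff_left)
  fix u assume uv: "u \<in> tangent_space M x" "v \<in> tangent_space M x"
  show "differential M normal x u \<bullet> v = u \<bullet> differential M normal x v"
    unfolding differential_smooth_on[OF smooth_on_normal x uv(1)]
      differential_smooth_on[OF smooth_on_normal x uv(2)] D_eq[OF has_derivative_normal]
    by (simp add: weingarten_self_adjoint)
qed

lemma shape_eq_weingarten:
  "x \<in> M \<Longrightarrow> v \<in> tangent_space M x \<Longrightarrow> shape x v = weingarten x v"
  by (simp add: shape_def differential_smooth_on[OF smooth_on_normal] D_eq[OF has_derivative_normal])

text \<open>
  The spherical gradient of the OT--FKM polynomial is \<open>8 s c\<close> times the polynomial normal field.
\<close>

lemma fkm_normal_eq: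
  assumes x: "x \<in> M"
  shows "fkm_normal m P x = normal x"
proof -
  let ?S = "sphere 0 1 :: (real^'n) set"
  have xS: "x \<in> ?S" using x by (simp add: fkm_hypersurface_def)
  have x': "x \<bullet> x = 1" "ip (coords x x) (coords x x) = s\<^sup>2" using x by (auto simp: M_iff)
  define w where "w = (8 * s * c) *\<^sub>R normal x"
  have w: "w = 8 *\<^sub>R (s\<^sup>2 *\<^sub>R x - cl (coords x x) x)"
    using s_c(1,2) by (simp add: w_def normal_def)
  have "((\<lambda>x. (x \<bullet> x)\<^sup>2 - 2 * ip (coords x x) (coords x x)) has_derivative
      (\<lambda>v. 2 * (x \<bullet> v + v \<bullet> x) * (x \<bullet> x) - 2 * (4 * (cl (coords x x) x \<bullet> v)))) (at x)"
    by (rule has_derivative_diff)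
      (auto intro!: derivative_eq_intros has_derivative_mult_right has_derivative_ip_coords)
  then have d: "(fkm_poly m P has_derivative
      (\<lambda>v. 2 * (x \<bullet> v + v \<bullet> x) * (x \<bullet> x) - 2 * (4 * (cl (coords x x) x \<bullet> v)))) (at x)"
    by (simp add: fkm_poly_eq[abs_def])
  have diff: "differential ?S (fkm_poly m P) x v = w \<bullet> v" if "v \<in> tangent_space ?S x" for v
    using differential_eq[OF d open_UNIV UNIV_I xS refl that] that
    by (simp add: w tangent_space_sphere[OF xS] inner_diff_left inner_commute[of v x])
  have wT: "w \<in> tangent_space ?S x"
    using normal_orthogonal[OF x] by (simp add: tangent_space_sphere[OF xS] w_def)
  have "gradient_on ?S (fkm_poly m P) x = w"
    unfolding gradient_on_def
  proof (rule the_equality)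
    show "w \<in> tangent_space ?S x \<and> (\<forall>v\<in>tangent_space ?S x. differential ?S (fkm_poly m P) x v = w \<bullet> v)"
      using wT diff by blast
    fix w' assume w': "w' \<in> tangent_space ?S x \<and>
      (\<forall>v\<in>tangent_space ?S x. differential ?S (fkm_poly m P) x v = w' \<bullet> v)"
    have "w' - w \<in> tangent_space ?S x"
      using w' wT by (simp add: tangent_space_sphere[OF xS] inner_diff_right)
    then have "w' \<bullet> (w' - w) = w \<bullet> (w' - w)" using w' diff by metis
    then have "(w' - w) \<bullet> (w' - w) = 0" by (simp add: inner_diff_left)
    then show "w' = w" by simp
  qed
  moreover have "norm w = 8 * s * c"
    using normal_unit[OF x] s_c(1,2) by (simp add: w_def norm_eq_1[symmetric] abs_mult)
  ultimately show ?thesis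
    using s_c(1,2) by (simp add: fkm_normal_def Let_def w_def field_simps)
qed

lemma principal_distribution_eq:
  assumes x: "x \<in> M"
  shows "principal_distribution m P \<theta> k x
    = {v \<in> tangent_space M x. weingarten x v = principal_curvature \<theta> k *\<^sub>R v}"
proof -
  have "shape_operator m P \<theta> x v = weingarten x v" if v: "v \<in> tangent_space M x" for v
  proof -
    have "differential M (fkm_normal m P) x v = differential M normal x v"
      by (rule differential_cong[OF smooth_normal _ x v]) (simp add: fkm_normal_eq)
    then show ?thesis
      using shape_eq_weingarten[OF x v] by (simp add: shape_operator_def shape_def)
  qed
  then show ?thesis unfolding principal_distribution_def by auto
qed

end

section \<open>Principal curvatures and principal distributions\<close>

text \<open>
  Lagrange interpolation for the two roots of the quadratic polynomial.
\<close>

lemma quadratic_eigen_split: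
  fixes A :: "'a::real_vector \<Rightarrow> 'a"
  assumes A: "linear A" and T: "subspace T" and inv: "\<And>v. v \<in> T \<Longrightarrow> A v \<in> T"
    and "a \<noteq> b" "w \<in> T" "A (A w) = (a + b) *\<^sub>R A w - (a * b) *\<^sub>R w"
  shows "\<exists>y z. y \<in> T \<and> A y = a *\<^sub>R y \<and> z \<in> T \<and> A z = b *\<^sub>R z \<and> w = y + z"
proof (intro exI conjI)
  let ?y = "(1 / (a - b)) *\<^sub>R (A w - b *\<^sub>R w)" and ?z = "(1 / (a - b)) *\<^sub>R (a *\<^sub>R w - A w)"
  show "?y \<in> T" "?z \<in> T"
    using assms(5) by (intro subspace_scale[OF T] subspace_diff[OF T] inv; assumption)+
  have "A (A w - b *\<^sub>R w) = a *\<^sub>R (A w - b *\<^sub>R w)" "A (a *\<^sub>R w - A w) = b *\<^sub>R (a *\<^sub>R w - A w)"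
    unfolding linear_diff[OF A] linear_scale[OF A] assms(6) by (simp_all add: algebra_simps)
  then show "A ?y = a *\<^sub>R ?y" "A ?z = b *\<^sub>R ?z"
    unfolding linear_scale[OF A] by (simp_all only: scaleR_scaleR mult.commute)
  have "?y + ?z = (1 / (a - b)) *\<^sub>R ((a - b) *\<^sub>R w)"
    unfolding scaleR_add_right[symmetric] by (simp add: scaleR_diff_left)
  then show "w = ?y + ?z" using assms(4) by simp
qed

text \<open>
  With \<open>R = NS + SN + (2/s)S\<close> the first quadratic polynomial in \<open>B\<close> is \<open>B\<^sup>2 - 1 = (2/s)R\<close>, and
  \<open>NSR + SNR = NR - sR\<close> turns the second one, \<open>B\<^sup>2 - (2/s)B + 1\<close>, into zero on the image of \<open>R\<close>. Geometrically,
  \<open>B\<^sup>2 - 1\<close> vanishes on the vectors annihilated by \<open>S\<close> and \<open>SN\<close>, and the second polynomial on the span of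
  the images of \<open>S\<close> and \<open>NS\<close>.
\<close>

lemma involution_projection_quartic:
  fixes N S :: "'a::real_vector \<Rightarrow> 'a" and s :: real
  assumes N: "linear N" "\<And>v. N (N v) = v" and S: "linear S" "\<And>v. S (S v) = S v"
    and s: "s \<noteq> 0"
    and SNS: "\<And>v. v \<in> T \<Longrightarrow> S (N (S v)) = - s *\<^sub>R S v"
    and v: "v \<in> T" "N v \<in> T"
    and B: "\<And>v. B v = N v + (2 / s) *\<^sub>R S v"
    and w: "w = B (B v) - v"
  shows "B (B w) - (2 / s) *\<^sub>R B w + w = 0"
proof -
  note lin = linear_add[OF N(1)] linear_scale[OF N(1)] linear_neg[OF N(1)] linear_diff[OF N(1)]
    linear_add[OF S(1)] linear_scale[OF S(1)] linear_neg[OF S(1)] linear_diff[OF S(1)]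
  have BB: "B (B u) = u + (2 / s) *\<^sub>R (N (S u) + S (N u) + (2 / s) *\<^sub>R S u)" for u
    by (simp add: B lin N(2) S(2) scaleR_add_right)
  define R where "R = N (S v) + S (N v) + (2 / s) *\<^sub>R S v"
  have wR: "w = (2 / s) *\<^sub>R R" unfolding w BB R_def by simp
  have SNSv: "S (N (S v)) = - s *\<^sub>R S v" "S (N (S (N v))) = - s *\<^sub>R S (N v)"
    using SNS v by simp_all
  have SR: "S R = S (N v) + (2 / s - s) *\<^sub>R S v"
    by (simp add: R_def lin S(2) SNSv scaleR_diff_left)
  have NR: "N R = S v + N (S (N v)) + (2 / s) *\<^sub>R N (S v)"
    by (simp add: R_def lin N(2))
  have SNR: "S (N R) = - S v - s *\<^sub>R S (N v)"
    unfolding NR using s by (simp add: lin S(2) SNSv scaleR_2)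
  have "N (S R) + S (N R) - N R = - s *\<^sub>R R"
    unfolding SR SNR unfolding NR R_def using s
    by (simp add: lin N(2) scaleR_diff_left scaleR_add_right scaleR_2)
  then have K: "N (S R) + S (N R) = N R - s *\<^sub>R R"
    by (simp add: algebra_simps)
  have "B (B R) - (2 / s) *\<^sub>R B R + R = 0"
    unfolding BB K unfolding B using s by (simp add: algebra_simps scaleR_2)
  moreover have "B (B w) - (2 / s) *\<^sub>R B w + w = (2 / s) *\<^sub>R (B (B R) - (2 / s) *\<^sub>R B R + R)"
    unfolding wR by (simp add: B lin algebra_simps)
  ultimately show ?thesis by simp
qed

lemma cot_quarter_shift:
  assumes "0 < \<phi>" "\<phi> < pi / 2"
  shows "cot \<phi> * cot (\<phi> + pi / 2) = -1" "cot \<phi> > 0" "cot (\<phi> + pi / 2) < 0"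
    "cot \<phi> + cot (\<phi> + pi / 2) = 2 * cos (2 * \<phi>) / sin (2 * \<phi>)"
proof -
  have p: "sin \<phi> > 0" "cos \<phi> > 0" using assms by (auto intro!: sin_gt_zero cos_gt_zero)
  have s: "cot (\<phi> + pi / 2) = - (sin \<phi> / cos \<phi>)"
    by (simp add: cot_def sin_add cos_add)
  show "cot \<phi> * cot (\<phi> + pi / 2) = -1" "cot \<phi> > 0" "cot (\<phi> + pi / 2) < 0"
    unfolding s using p by (simp_all add: cot_def)
  show "cot \<phi> + cot (\<phi> + pi / 2) = 2 * cos (2 * \<phi>) / sin (2 * \<phi>)"
    unfolding s cos_double sin_double using p by (simp add: cot_def field_simps power2_eq_square)
qed

context fkm
begin

text \<open>
  The coordinates of the element \<open>N\<close> of the Clifford sphere determined by the point \<open>x\<close>.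
\<close>

definition unit_coords :: "real^'n \<Rightarrow> nat \<Rightarrow> real" where
  "unit_coords x i = (1 / s) * coords x x i"

lemma ip_unit_coords:
  assumes "x \<in> M"
  shows "ip (unit_coords x) (unit_coords x) = 1"
proof -
  have "ip (unit_coords x) (unit_coords x) = (1 / s) * ((1 / s) * ip (coords x x) (coords x x))"
    unfolding unit_coords_def[abs_def] ip_scaleR_left ip_commute[of "coords x x" "\<lambda>i. _ * coords x x i"] ..
  then show ?thesis using assms s_c(1) by (simp add: M_iff power2_eq_square)
qed

lemma cl_coords_unit: "cl (coords x x) v = s *\<^sub>R cl (unit_coords x) v"
  unfolding unit_coords_def[abs_def] cl_scaleR_left using s_c(1) by simp

lemma cl_unit_involution: "x \<in> M \<Longrightarrow> cl (unit_coords x) (cl (unit_coords x) v) = v"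
  by (simp add: cl_square ip_unit_coords)

lemma tangent_unit_iff:
  "x \<in> M \<Longrightarrow> v \<in> tangent_space M x \<longleftrightarrow> x \<bullet> v = 0 \<and> cl (unit_coords x) x \<bullet> v = 0"
  using s_c(1) by (simp add: tangent_space_M cl_coords_unit)

lemma cl_unit_tangent:
  assumes "x \<in> M" "v \<in> tangent_space M x"
  shows "cl (unit_coords x) v \<in> tangent_space M x"
  using assms cl_self_adjoint[of "unit_coords x" x] cl_unit_involution[OF assms(1)]
  by (simp add: tangent_unit_iff)

lemma linear_coords_cl: "linear (\<lambda>v. cl (coords x v) x)"
  by (rule linearI)
    (simp_all add: cl_def coords_def inner_add_right scaleR_add_left sum.distrib scaleR_sum_right)

lemma coords_cl_self: "x \<in> M \<Longrightarrow> i \<le> m \<Longrightarrow> coords x (cl a x) i = a i"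
  by (simp add: coords_cl cl_inner_cl ip_unit M_iff)

lemma cl_coords_idempotent:
  assumes "x \<in> M"
  shows "cl (coords x (cl (coords x v) x)) x = cl (coords x v) x"
  by (rule cl_cong) (rule coords_cl_self[OF assms])

text \<open>
  The relation \<open>SNS = -s S\<close>: for \<open>v\<close> tangent, \<open>coords x v\<close> is orthogonal to \<open>N\<close>, and in \<open>cl_triple\<close> only the
  middle term remains, where \<open>ip n (coords x x)\<close> is \<open>s\<close>.
\<close>

lemma cl_coords_unit_sandwich:
  assumes x: "x \<in> M" and v: "v \<in> tangent_space M x"
  shows "cl (coords x (cl (unit_coords x) (cl (coords x v) x))) x = - s *\<^sub>R cl (coords x v) x"
proof -
  let ?a = "coords x v" and ?n = "unit_coords x"
  have an: "ip ?a ?n = 0" "ip ?n ?a = 0"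
    using v cl_inner_coords[of ?n x v] by (simp_all add: tangent_unit_iff[OF x] ip_commute)
  have "coords x x = (\<lambda>i. s * ?n i)" using s_c(1) by (auto simp: unit_coords_def)
  then have q: "ip b (coords x x) = s * ip b ?n" for b
    using ip_scaleR_left[of s ?n b] by (simp add: ip_commute)
  have "coords x (cl ?n (cl ?a x)) i = - s * ?a i" if "i \<le> m" for i
    unfolding coords_cl[OF that] cl_triple q an ip_unit_coords[OF x]
    by (simp add: ip_commute[of ?a] ip_unit that)
  then have "cl (coords x (cl ?n (cl ?a x))) x = cl (\<lambda>i. - s * ?a i) x" by (rule cl_cong)
  then show ?thesis unfolding cl_scaleR_left .
qed

text \<open>
  The quadratic polynomials are \<open>(t - \<lambda>\<^sub>2)(t - \<lambda>\<^sub>4)\<close> and \<open>(t - \<lambda>\<^sub>1)(t - \<lambda>\<^sub>3)\<close>. In terms of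
  \<open>B = c A + s = N + (2/s) S\<close> they are, up to the factor \<open>c\<^sup>2\<close>, the two polynomials of
  \<open>involution_projection_quartic\<close>.
\<close>

lemma weingarten_quartic:
  assumes x: "x \<in> M" and v: "v \<in> tangent_space M x"
    and w: "w = weingarten x (weingarten x v) + (2 * s / c) *\<^sub>R weingarten x v - v"
  shows "weingarten x (weingarten x w) - (2 * c / s) *\<^sub>R weingarten x w - w = 0"
proof -
  let ?A = "weingarten x"
  define B where "B u = cl (unit_coords x) u + (2 / s) *\<^sub>R cl (coords x u) x" for u
  note A = linear_scale[OF linear_weingarten] linear_add[OF linear_weingarten]
    linear_diff[OF linear_weingarten]
  have AB: "B u = c *\<^sub>R ?A u + s *\<^sub>R u" for u
    using s_c(1,2)
    by (simp add: B_def weingarten_def cl_coords_unit scaleR_add_right scaleR_diff_right power2_eq_square)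
  have BB: "B (B u) = c\<^sup>2 *\<^sub>R ?A (?A u) + (2 * s * c) *\<^sub>R ?A u + s\<^sup>2 *\<^sub>R u" for u
  proof -
    have "(2 * s * c) *\<^sub>R ?A u = (s * c) *\<^sub>R ?A u + (s * c) *\<^sub>R ?A u"
      by (simp flip: scaleR_add_left)
    then show ?thesis
      by (simp add: AB A scaleR_add_right power2_eq_square mult.commute[of c s] add.assoc)
  qed
  have "B (B (B (B v) - v)) - (2 / s) *\<^sub>R B (B (B v) - v) + (B (B v) - v) = 0"
    by (rule involution_projection_quartic[where N = "cl (unit_coords x)" and S = "\<lambda>u. cl (coords x u) x"
          and T = "tangent_space M x" and v = v])
      (use x v s_c(1) in \<open>auto intro: linear_cl linear_coords_cl cl_unit_tangent
        simp: cl_unit_involution cl_coords_idempotent cl_coords_unit_sandwich B_def\<close>)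
  moreover have "B (B v) - v = c\<^sup>2 *\<^sub>R w"
  proof -
    have "c\<^sup>2 * (2 * s / c) = 2 * s * c" using s_c(2) by (simp add: power2_eq_square)
    moreover have "s\<^sup>2 *\<^sub>R v - v = - (c\<^sup>2 *\<^sub>R v)" by (simp add: s_c(5) scaleR_diff_left)
    ultimately show ?thesis
      unfolding BB w scaleR_add_right scaleR_diff_right scaleR_scaleR
      by (simp only: add_diff_eq[symmetric]) simp
  qed
  ultimately have "B (B (c\<^sup>2 *\<^sub>R w)) - (2 / s) *\<^sub>R B (c\<^sup>2 *\<^sub>R w) + c\<^sup>2 *\<^sub>R w = 0" by simp
  moreover have "B (c\<^sup>2 *\<^sub>R u) = c\<^sup>2 *\<^sub>R B u" for u by (simp add: AB A algebra_simps)
  ultimately have "c\<^sup>2 *\<^sub>R (B (B w) - (2 / s) *\<^sub>R B w + w) = 0"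
    by (simp add: algebra_simps)
  then have 0: "B (B w) - (2 / s) *\<^sub>R B w + w = 0" using s_c(2) by simp
  have coeff: "2 * s * c - 2 / s * c = c\<^sup>2 * (- (2 * c / s))" "s\<^sup>2 - 2 / s * s + 1 = c\<^sup>2 * (-1)"
    unfolding s_c(5) using s_c(1) by (simp_all add: field_simps power2_eq_square)
  have "B (B w) - (2 / s) *\<^sub>R B w + w
      = c\<^sup>2 *\<^sub>R ?A (?A w) + (2 * s * c - 2 / s * c) *\<^sub>R ?A w + (s\<^sup>2 - 2 / s * s + 1) *\<^sub>R w"
    unfolding BB unfolding AB by (simp add: algebra_simps)
  also have "\<dots> = c\<^sup>2 *\<^sub>R (?A (?A w) - (2 * c / s) *\<^sub>R ?A w - w)"
    unfolding coeff scaleR_scaleR[symmetric] by (simp add: scaleR_diff_right)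
  finally show ?thesis using 0 s_c(2) by simp
qed

abbreviation pdist :: "nat \<Rightarrow> real^'n \<Rightarrow> (real^'n) set" where
  "pdist \<equiv> principal_distribution m P \<theta>"

abbreviation curv :: "nat \<Rightarrow> real" where
  "curv \<equiv> principal_curvature \<theta>"

text \<open>
  The principal curvatures with numbers 1 and 2 are positive, those with numbers 3 and 4 negative.
\<close>

definition pos_space :: "real^'n \<Rightarrow> (real^'n) set" where
  "pos_space x = {y + z |y z. y \<in> pdist 1 x \<and> z \<in> pdist 2 x}"

definition neg_space :: "real^'n \<Rightarrow> (real^'n) set" where
  "neg_space x = {y + z |y z. y \<in> pdist 3 x \<and> z \<in> pdist 4 x}"

lemma pdistD:
  assumes "x \<in> M" "v \<in> pdist k x"
  shows "v \<in> tangent_space M x" "weingarten x v = curv k *\<^sub>R v" "shape x v = curv k *\<^sub>R v"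
  using assms shape_eq_weingarten[OF assms(1)] by (auto simp: principal_distribution_eq)

lemma curv_facts:
  "curv 1 * curv 3 = -1" "curv 2 * curv 4 = -1"
  "curv 1 + curv 3 = 2 * c / s" "curv 2 + curv 4 = - (2 * s / c)"
  "curv 1 > 0" "curv 2 > 0" "curv 3 < 0" "curv 4 < 0"
proof -
  have eqs: "curv 1 = cot \<theta>" "curv 3 = cot (\<theta> + pi / 2)"
    "curv 2 = cot (\<theta> + pi / 4)" "curv 4 = cot (\<theta> + pi / 4 + pi / 2)"
    by (simp_all add: principal_curvature_def add.assoc)
  \<comment> \<open>The pairs 1, 3 and 2, 4 are both of the form \<open>\<phi>\<close>, \<open>\<phi> + \<pi>/2\<close>, with \<open>\<phi> = \<theta>\<close> and \<open>\<phi> = \<theta> + \<pi>/4\<close>.\<close>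
  have "cos (2 * (\<theta> + pi / 4)) = - s" "sin (2 * (\<theta> + pi / 4)) = c"
    by (simp_all add: s_def c_def distrib_left cos_add sin_add)
  then show "curv 1 * curv 3 = -1" "curv 2 * curv 4 = -1"
    "curv 1 + curv 3 = 2 * c / s" "curv 2 + curv 4 = - (2 * s / c)"
    "curv 1 > 0" "curv 2 > 0" "curv 3 < 0" "curv 4 < 0"
    using cot_quarter_shift[of \<theta>] cot_quarter_shift[of "\<theta> + pi / 4"] theta
    unfolding eqs by (simp_all add: s_def c_def)
qed

lemma curv_3_neq_4: "curv 3 \<noteq> curv 4"
proof
  assume eq: "curv 3 = curv 4"
  have "curv 3 * (curv 1 - curv 2) = 0"
    using curv_facts(1,2) eq by (simp add: algebra_simps)
  then have "curv 1 = curv 2" using curv_facts(7) by simp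
  then have "2 * c / s = - (2 * s / c)" using curv_facts(3,4) eq by simp
  moreover have "2 * c / s > 0" "2 * s / c > 0" using s_c(1,2) by simp_all
  ultimately show False by simp
qed

lemma subspace_eigenspaces:
  assumes x: "x \<in> M"
  shows "subspace (pdist k x)" "subspace (pos_space x)" "subspace (neg_space x)"
proof -
  show sub: "subspace (pdist k x)" for k
    unfolding principal_distribution_eq[OF x] subspace_def
    using subspace_tangent[OF x] linear_weingarten[of x]
    by (auto simp: linear_0 linear_add linear_scale subspace_0 subspace_add subspace_scale scaleR_add_right)
  show "subspace (pos_space x)" "subspace (neg_space x)"
    unfolding pos_space_def neg_space_def by (intro subspace_sums sub)+
qed

lemma eigenspaces_tangent:
  assumes x: "x \<in> M"
  shows "pos_space x \<subseteq> tangent_space M x" "neg_space x \<subseteq> tangent_space M x"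
  using pdistD(1)[OF x] subspace_add[OF subspace_tangent[OF x]]
  unfolding pos_space_def neg_space_def by blast+

text \<open>
  Let \<open>w\<close> and \<open>w'\<close> be the two quadratic polynomials in \<open>A\<close>. By the quartic relation each of \<open>w u\<close> and
  \<open>w' u\<close> is annihilated by the other polynomial, hence a sum of two eigenvectors. The difference
  \<open>w u - w' u\<close> is a nonzero multiple of \<open>A u\<close>, so the image of \<open>A\<close> is spanned by eigenvectors; and \<open>v\<close> is
  recovered from \<open>w v\<close>, \<open>A v\<close> and \<open>A (A v)\<close> because the constant term of \<open>w\<close> is \<open>-1\<close>.
\<close>

lemma tangent_space_eq_sum:
  assumes x: "x \<in> M" and v: "v \<in> tangent_space M x"
  shows "v \<in> {y + z |y z. y \<in> pos_space x \<and> z \<in> neg_space x}" (is "v \<in> ?E")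
proof -
  let ?A = "weingarten x" and ?T = "tangent_space M x"
  note A = linear_add[OF linear_weingarten] linear_diff[OF linear_weingarten]
    linear_scale[OF linear_weingarten]
  note subT = subspace_tangent[OF x]
  have AT: "?A u \<in> ?T" if "u \<in> ?T" for u
    using shape_tangent[OF x that] shape_eq_weingarten[OF x that] by simp
  have subE: "subspace ?E" by (intro subspace_sums subspace_eigenspaces[OF x])
  have in_pos: "y + z \<in> pos_space x" if "y \<in> pdist 1 x" "z \<in> pdist 2 x" for y z
    using that unfolding pos_space_def by blast
  have in_neg: "y + z \<in> neg_space x" if "y \<in> pdist 3 x" "z \<in> pdist 4 x" for y z
    using that unfolding neg_space_def by blast
  have zero: "0 \<in> pdist k x" for k by (rule subspace_0[OF subspace_eigenspaces(1)[OF x]])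
  have E13: "y + z \<in> ?E" if "y \<in> pdist 1 x" "z \<in> pdist 3 x" for y z
    using in_pos[OF that(1) zero] in_neg[OF that(2) zero] by auto
  have E24: "y + z \<in> ?E" if "y \<in> pdist 2 x" "z \<in> pdist 4 x" for y z
    using in_pos[OF zero that(1)] in_neg[OF zero that(2)] by auto
  define w where "w u = ?A (?A u) + (2 * s / c) *\<^sub>R ?A u - u" for u
  define w' where "w' u = ?A (?A u) - (2 * c / s) *\<^sub>R ?A u - u" for u
  have w'w: "w' (w u) = 0" if "u \<in> ?T" for u
    using weingarten_quartic[OF x that] by (simp add: w_def w'_def)
  have ww': "w (w' u) = w' (w u)" for u
    by (simp add: w_def w'_def A scaleR_add_right scaleR_diff_right mult.commute)
  have wT: "w u \<in> ?T" "w' u \<in> ?T" if "u \<in> ?T" for u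
    unfolding w_def w'_def
    by (intro subspace_diff[OF subT] subspace_add[OF subT] subspace_scale[OF subT] AT that)+
  have wE: "w u \<in> ?E" if u: "u \<in> ?T" for u
  proof -
    have "?A (?A (w u)) = (curv 1 + curv 3) *\<^sub>R ?A (w u) - (curv 1 * curv 3) *\<^sub>R w u"
      using w'w[OF u] unfolding curv_facts w'_def by (simp add: algebra_simps)
    then obtain y z where "y \<in> ?T" "?A y = curv 1 *\<^sub>R y" "z \<in> ?T" "?A z = curv 3 *\<^sub>R z" "w u = y + z"
      using quadratic_eigen_split[OF linear_weingarten subT AT _ wT(1)[OF u], of "curv 1" "curv 3"]
        curv_facts(5,7) by auto
    then show ?thesis using E13 by (simp add: principal_distribution_eq[OF x])
  qed
  have w'E: "w' u \<in> ?E" if u: "u \<in> ?T" for u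
  proof -
    have "?A (?A (w' u)) = (curv 2 + curv 4) *\<^sub>R ?A (w' u) - (curv 2 * curv 4) *\<^sub>R w' u"
      using w'w[OF u] unfolding ww'[symmetric] curv_facts w_def[of "w' u"] by (simp add: algebra_simps)
    then obtain y z where "y \<in> ?T" "?A y = curv 2 *\<^sub>R y" "z \<in> ?T" "?A z = curv 4 *\<^sub>R z" "w' u = y + z"
      using quadratic_eigen_split[OF linear_weingarten subT AT _ wT(2)[OF u], of "curv 2" "curv 4"]
        curv_facts(6,8) by auto
    then show ?thesis using E24 by (simp add: principal_distribution_eq[OF x])
  qed
  have AE: "?A u \<in> ?E" if u: "u \<in> ?T" for u
  proof -
    have pos: "2 * s / c + 2 * c / s > 0" using s_c(1,2) by (simp add: add_pos_pos)
    have "w u - w' u = (2 * s / c + 2 * c / s) *\<^sub>R ?A u"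
      by (simp add: w_def w'_def scaleR_add_left)
    then have "?A u = (1 / (2 * s / c + 2 * c / s)) *\<^sub>R (w u - w' u)" using pos by simp
    then show ?thesis
      by (rule ssubst) (rule subspace_scale[OF subE subspace_diff[OF subE wE[OF u] w'E[OF u]]])
  qed
  have "v = ?A (?A v) + (2 * s / c) *\<^sub>R ?A v - w v" by (simp add: w_def)
  also have "\<dots> \<in> ?E"
    by (intro subspace_diff[OF subE] subspace_add[OF subE] subspace_scale[OF subE] AE AT wE v)
  finally show ?thesis .
qed

lemma weingarten_neg_space:
  assumes x: "x \<in> M" and v: "v \<in> neg_space x"
  shows "weingarten x v \<bullet> v \<le> 0"
proof -
  obtain y z where yz: "y \<in> pdist 3 x" "z \<in> pdist 4 x" "v = y + z"
    using v unfolding neg_space_def by blast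
  note Ay = pdistD(2)[OF x yz(1)] and Az = pdistD(2)[OF x yz(2)]
  have "curv 3 * (y \<bullet> z) = curv 4 * (y \<bullet> z)"
    using weingarten_self_adjoint[of x y z] by (simp add: Ay Az)
  then have "y \<bullet> z = 0" using curv_3_neq_4 by simp
  then have "weingarten x v \<bullet> v = curv 3 * (y \<bullet> y) + curv 4 * (z \<bullet> z)"
    by (simp add: yz(3) linear_add[OF linear_weingarten] Ay Az inner_add_left inner_add_right inner_commute)
  also have "\<dots> \<le> 0"
    using curv_facts(7,8) by (intro add_nonpos_nonpos mult_nonpos_nonneg) auto
  finally show ?thesis .
qed

lemma weingarten_fixed_pos:
  assumes x: "x \<in> M" and v: "cl (unit_coords x) v = v" "v \<noteq> 0"
  shows "weingarten x v \<bullet> v > 0"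
proof -
  have "weingarten x v \<bullet> v
      = (1 / (s * c)) * (s * (1 - s) * (v \<bullet> v) + 2 * ip (coords x v) (coords x v))"
    by (simp add: weingarten_def cl_coords_unit v(1) inner_add_left inner_diff_left cl_inner_coords
        power2_eq_square algebra_simps)
  also have "\<dots> > 0"
    using s_c v(2) ip_nonneg by (intro mult_pos_pos add_pos_nonneg) auto
  finally show ?thesis .
qed

text \<open>
  Let \<open>F\<close> be the space of tangent vectors fixed by \<open>N\<close>. It has codimension at most one in the fixed space
  of \<open>N\<close>, because a fixed vector orthogonal to \<open>x\<close> is orthogonal to \<open>N x\<close> as well; hence its dimension is
  at least half of that of the tangent space. As \<open>A\<close> is positive on \<open>F\<close> and not on the negative
  eigenspaces, the latter meet \<open>F\<close> only in \<open>0\<close>, so their dimension is at most the other half.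
\<close>

lemma dim_neg_le_pos:
  assumes x: "x \<in> M" and m: "m \<ge> 1"
  shows "dim (neg_space x) \<le> dim (pos_space x)"
proof -
  let ?T = "tangent_space M x" and ?N = "cl (unit_coords x)"
  let ?V = "{v. ?N v = v}" and ?H = "{v. x \<bullet> v = 0}"
  note sub = subspace_eigenspaces(2,3)[OF x] and subT = subspace_tangent[OF x]
  have subV: "subspace ?V" by (auto simp: subspace_def cl_linear_simps linear_0[OF linear_cl])
  have subH: "subspace ?H" by (rule subspace_hyperplane)
  have x0: "x \<bullet> x = 1" "x \<noteq> 0" using x on_sphere[OF x] by auto
  have VH: "?V \<inter> ?H \<subseteq> ?T"
  proof safe
    fix v assume "?N v = v" "x \<bullet> v = 0"
    then show "v \<in> ?T"
      using cl_self_adjoint[of "unit_coords x" x v] by (simp add: tangent_unit_iff[OF x])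
  qed
  have "dim ?V + (CARD('n) - 1) \<le> CARD('n) + dim (?V \<inter> ?H)"
    using dim_sums_Int[OF subV subH] dim_subset_UNIV[of "{y + z |y z. y \<in> ?V \<and> z \<in> ?H}"]
      dim_hyperplane[OF x0(2)] by simp
  moreover have "CARD('n) \<le> 2 * dim ?V" by (rule dim_cl_fixed[OF m ip_unit_coords[OF x]])
  moreover have "CARD('n) > 0" by simp
  ultimately have F: "CARD('n) \<le> 2 * dim (?V \<inter> ?H) + 2" by linarith
  have "dim ?T + 2 \<le> CARD('n)"
  proof -
    let ?B = "{x, normal x}"
    have n: "normal x \<noteq> 0" "x \<noteq> normal x"
      using normal_unit[OF x] normal_orthogonal[OF x] x0 by auto
    have "independent ?B"
      by (rule pairwise_orthogonal_independent)
        (use n x0 normal_orthogonal[OF x] in \<open>auto simp: pairwise_def orthogonal_def inner_commute\<close>)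
    then have B: "dim (span ?B) = 2" using n by (simp add: dim_eq_card_independent)
    have "?T \<subseteq> {y \<in> UNIV. \<forall>b\<in>span ?B. orthogonal b y}"
    proof safe
      fix v b assume v: "v \<in> ?T" and b: "b \<in> span ?B"
      have "\<And>b. b \<in> ?B \<Longrightarrow> orthogonal v b"
        using v tangent_iff[OF x] by (auto simp: orthogonal_def inner_commute)
      then show "orthogonal b v" using orthogonal_to_span[OF b] orthogonal_commute by blast
    qed auto
    then have "dim ?T \<le> dim {y \<in> UNIV. \<forall>b\<in>span ?B. orthogonal b y}" by (rule dim_subset)
    with dim_subspace_orthogonal_to_vectors[OF subspace_span subspace_UNIV subset_UNIV, of ?B] B
    show ?thesis by (simp add: dim_UNIV)
  qed
  moreover have "dim (neg_space x) + dim (?V \<inter> ?H) \<le> dim ?T"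
  proof -
    have "v = 0" if "v \<in> neg_space x \<inter> (?V \<inter> ?H)" for v
      using weingarten_neg_space[OF x, of v] weingarten_fixed_pos[OF x, of v] that by force
    then have "dim (neg_space x \<inter> (?V \<inter> ?H)) = 0" by (subst dim_eq_0) auto
    moreover have "{y + z |y z. y \<in> neg_space x \<and> z \<in> ?V \<inter> ?H} \<subseteq> ?T"
      using eigenspaces_tangent(2)[OF x] VH subspace_add[OF subT] by blast
    ultimately show ?thesis
      using dim_sums_Int[OF sub(2) subspace_inter[OF subV subH]]
        dim_subset[of "{y + z |y z. y \<in> neg_space x \<and> z \<in> ?V \<inter> ?H}" ?T] by linarith
  qed
  moreover have "dim ?T \<le> dim (pos_space x) + dim (neg_space x)"
    using dim_sums_Int[OF sub] dim_subset[of ?T "{y + z |y z. y \<in> pos_space x \<and> z \<in> neg_space x}"]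
      tangent_space_eq_sum[OF x] by (simp add: subset_iff)
  ultimately show ?thesis using F by linarith
qed

section \<open>Vanishing of the *-Ricci curvature\<close>

text \<open>
  \<open>J\<close> embeds the positive eigenspaces into the negative ones, and by \<open>dim_neg_le_pos\<close> onto them. So
  every tangent vector is \<open>p + J q\<close> with \<open>p\<close>, \<open>q\<close> sums of eigenvectors with positive eigenvalues, and
  \<open>AJAJ\<close> fixes \<open>u\<close> and \<open>J u\<close> whenever \<open>u\<close> is such an eigenvector.
\<close>

lemma shape_J_shape_J:
  assumes J: "almost_hermitian M J" and x: "x \<in> M" and m: "m \<ge> 1"
    and J13: "J x ` pdist 1 x \<subseteq> pdist 3 x" and J24: "J x ` pdist 2 x \<subseteq> pdist 4 x"
    and v: "v \<in> tangent_space M x"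
  shows "shape x (J x (shape x (J x v))) = v"
proof -
  let ?T = "tangent_space M x" and ?J = "J x" and ?A = "weingarten x"
  note subT = subspace_tangent[OF x]
  have JT: "?J u \<in> ?T" and JJ: "?J (?J u) = - u" if "u \<in> ?T" for u
    using J x that unfolding almost_hermitian_def by blast+
  have Jlin: "?J (a *\<^sub>R u + b *\<^sub>R w) = a *\<^sub>R ?J u + b *\<^sub>R ?J w" if "u \<in> ?T" "w \<in> ?T" for u w a b
    using J x that unfolding almost_hermitian_def by blast
  have Jadd: "?J (u + w) = ?J u + ?J w" if "u \<in> ?T" "w \<in> ?T" for u w
    using Jlin[OF that, of 1 1] by simp
  have Jscale: "?J (a *\<^sub>R u) = a *\<^sub>R ?J u" if "u \<in> ?T" for u a
    using Jlin[OF that that, of a 0] by simp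
  \<comment> \<open>The field \<open>J\<close> is linear on the tangent space only; \<open>K\<close> extends it linearly.\<close>
  define K where "K u = ?J (tproj x u)" for u
  have KJ: "K u = ?J u" if "u \<in> ?T" for u using tproj_ident[OF x that] by (simp add: K_def)
  have linK: "linear K"
    by (rule linearI)
      (simp_all add: K_def linear_add[OF linear_tproj] linear_scale[OF linear_tproj] Jadd Jscale tproj_tangent[OF x])
  have "K ` pos_space x \<subseteq> neg_space x"
  proof safe
    fix u assume u: "u \<in> pos_space x"
    then obtain y z where yz: "y \<in> pdist 1 x" "z \<in> pdist 2 x" "u = y + z"
      unfolding pos_space_def by blast
    then have "K u = ?J y + ?J z"
      using KJ u eigenspaces_tangent(1)[OF x] Jadd pdistD(1)[OF x] by auto
    then show "K u \<in> neg_space x" using yz J13 J24 unfolding neg_space_def by blast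
  qed
  moreover have "dim (K ` pos_space x) = dim (pos_space x)"
  proof (rule dim_image_eq[OF linK])
    have "inj_on K ?T"
      by (rule inj_on_inverseI[of _ "\<lambda>y. - ?J y"]) (simp add: KJ JJ)
    then show "inj_on K (span (pos_space x))"
      using eigenspaces_tangent(1)[OF x] subspace_eigenspaces(2)[OF x]
      by (simp add: span_eq_iff[THEN iffD2] inj_on_subset)
  qed
  ultimately have onto: "K ` pos_space x = neg_space x"
    using dim_neg_le_pos[OF x m] subspace_eigenspaces[OF x] linear_subspace_image[OF linK]
    by (intro subspace_dim_equal) auto
  define L where "L u = shape x (?J (shape x (?J u)))" for u
  have step: "L u = u \<and> L (?J u) = ?J u"
    if u: "u \<in> pdist a x" "?J u \<in> pdist b x" and ab: "curv a * curv b = -1" for u a b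
  proof -
    note Tu = pdistD[OF x u(1)] pdistD[OF x u(2)]
    have neg: "shape x (- u) = - (curv a *\<^sub>R u)"
      using shape_eq_weingarten[OF x subspace_neg[OF subT Tu(1)]] Tu
      by (simp add: linear_neg[OF linear_weingarten])
    have sc: "shape x (r *\<^sub>R w) = r *\<^sub>R shape x w" if "w \<in> ?T" for r w
      using shape_eq_weingarten[OF x] that subspace_scale[OF subT that]
      by (simp add: linear_scale[OF linear_weingarten])
    have "?J (- (curv a *\<^sub>R u)) = - (curv a *\<^sub>R ?J u)" using Jscale[OF Tu(1), of "- curv a"] by simp
    moreover have "shape x (- (curv a *\<^sub>R ?J u)) = ?J u"
      using sc[OF Tu(4), of "- curv a"] Tu ab by simp
    moreover have "?J (curv b *\<^sub>R ?J u) = - (curv b *\<^sub>R u)"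
      using Jscale[OF Tu(4)] JJ[OF Tu(1)] by simp
    moreover have "shape x (- (curv b *\<^sub>R u)) = u"
      using sc[OF Tu(1), of "- curv b"] Tu ab by (simp add: mult.commute)
    ultimately show ?thesis using Tu JJ[OF Tu(1)] neg by (simp add: L_def)
  qed
  have Ladd: "L (u + w) = L u + L w" if "u \<in> ?T" "w \<in> ?T" for u w
  proof -
    have Aadd: "shape x (u + w) = shape x u + shape x w" if "u \<in> ?T" "w \<in> ?T" for u w
      using shape_eq_weingarten[OF x] that subspace_add[OF subT that]
      by (simp add: linear_add[OF linear_weingarten])
    show ?thesis using that by (simp add: L_def Jadd Aadd JT shape_tangent[OF x])
  qed
  obtain p q where pq: "p \<in> pos_space x" "q \<in> pos_space x" "v = p + ?J q"
  proof -
    obtain p r where pr: "p \<in> pos_space x" "r \<in> neg_space x" "v = p + r"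
      using tangent_space_eq_sum[OF x v] by blast
    then obtain q where q: "q \<in> pos_space x" "r = K q" using onto by blast
    then have "r = ?J q" using KJ eigenspaces_tangent(1)[OF x] by blast
    then show ?thesis using that[OF pr(1) q(1)] pr(3) by simp
  qed
  have fix_pos: "L u = u \<and> L (?J u) = ?J u" if u: "u \<in> pos_space x" for u
  proof -
    obtain y z where yz: "y \<in> pdist 1 x" "z \<in> pdist 2 x" "u = y + z"
      using u unfolding pos_space_def by blast
    have "?J y \<in> pdist 3 x" "?J z \<in> pdist 4 x" using yz J13 J24 by auto
    with step[OF yz(1)] step[OF yz(2)] curv_facts(1,2)
    have "L y = y \<and> L (?J y) = ?J y" "L z = z \<and> L (?J z) = ?J z" by blast+
    moreover have "y \<in> ?T" "z \<in> ?T" using yz pdistD(1)[OF x] by auto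
    ultimately show ?thesis using yz(3) by (simp add: Ladd Jadd JT)
  qed
  have "p \<in> ?T" "?J q \<in> ?T" using pq eigenspaces_tangent(1)[OF x] JT by auto
  then have "L v = v" using pq(3) Ladd fix_pos[OF pq(1)] fix_pos[OF pq(2)] by simp
  then show ?thesis by (simp only: L_def)
qed

end

theorem proposition1p3:
  fixes P :: "nat \<Rightarrow> real^'n^'n"
    and m l :: nat
    and \<theta> :: real
    and M :: "(real^'n) set"
    and J :: "real^'n \<Rightarrow> real^'n \<Rightarrow> real^'n"
  assumes "CARD('n) = 2 * l"
    and "m \<ge> 1"
    and "l - m - 1 > 0"
    and "clifford_system m P"
    and "0 < \<theta>" and "\<theta> < pi / 4"
    and "M = fkm_hypersurface m P \<theta>"
    and "almost_hermitian M J"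
    and "\<forall>x\<in>M. J x ` principal_distribution m P \<theta> 1 x \<subseteq> principal_distribution m P \<theta> 3 x"
    and "\<forall>x\<in>M. J x ` principal_distribution m P \<theta> 2 x \<subseteq> principal_distribution m P \<theta> 4 x"
  shows "\<forall>x\<in>M. \<forall>u\<in>tangent_space M x. \<forall>v\<in>tangent_space M x. star_ricci M J x u v = 0"
proof -
  interpret fkm m P \<theta>
    using assms by unfold_locales auto
  show ?thesis
    unfolding assms(7)
    using star_ricci_eq_0[OF assms(8)[unfolded assms(7)]]
      shape_J_shape_J[OF assms(8)[unfolded assms(7)] _ assms(2)] assms(9,10)[unfolded assms(7)]
    by blast
qed

end
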